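(* Let $(R,\mathfrak m,k)$ be a complete Noetherian local ring and let $\mathrm{cl}$ be a residual Nakayama closure operation on the class of finitely generated (Noetherian) $R$-modules. Let $\mathrm i$ be the dual interior operation, defined on Artinian $R$-modules $A$ by $$\mathrm i(A)=\left(\frac{A^\vee}{0^{\mathrm{cl}}_{A^\vee}}\right)^\vee ,$$ regarded as a submodule of $A\cong A^{\vee\vee}$. Then $\mathrm i$ is a Nakayama interior operation on Artinian $R$-modules. Moreover, let $A\subseteq B$ be Artinian $R$-modules. Then: (1) There exists an order-reversing one-to-one correspondence between the $\mathrm i$-expansions of $A$ in $B$ and the $\mathrm{cl}$-reductions of $(B/A)^\vee$ in $B^\vee$. (2) Every $\mathrm i$-expansion of $A$ in $B$ is contained in a maximal $\mathrm i$-expansion of $A$ in $B$. (3) The $\mathrm i$-hull of $A$ in $B$ exists and is dual to the $\mathrm{cl}$-core of $(B/A)^\vee$ in $B^\vee$; that is, as submodules of $B$, $$\mathrm i\text{-hull}^B(A)=\left(\frac{B^\vee}{\mathrm{cl}\text{-core}_{B^\vee}\big((B/A)^\vee\big)}\right)^\vee .$$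
   Context: $E=E_R(k)$ and $(-)^\vee=\mathrm{Hom}_R(-,E)$ is Matlis duality. For $A\subseteq B$, $(B/A)^\vee$ is regarded as the submodule of $B^\vee$ of maps killing $A$; for a submodule $L\subseteq B^\vee$ with $B$ Artinian, $(B^\vee/L)^\vee$ is regarded as a submodule of $B\cong B^{\vee\vee}$. A closure operation $\mathrm{cl}$ on a class $\mathcal M$ of modules (closed under submodules and quotients) assigns to each $L\subseteq M\in\mathcal M$ a module $L\subseteq L^{\mathrm{cl}}_M\subseteq M$ such that $(L^{\mathrm{cl}}_M)^{\mathrm{cl}}_M=L^{\mathrm{cl}}_M$ and $L\subseteq N\subseteq M$ implies $L^{\mathrm{cl}}_M\subseteq N^{\mathrm{cl}}_M$. It is residual if for every surjection $q:M\twoheadrightarrow P$ in $\mathcal M$, $(\ker q)^{\mathrm{cl}}_M=q^{-1}(0^{\mathrm{cl}}_P)$. It is Nakayama (on finitely generated modules) if whenever $L\subseteq N\subseteq M$ are finitely generated with $N\subseteq (L+\mathfrak mN)^{\mathrm{cl}}_M$, then $L^{\mathrm{cl}}_M=N^{\mathrm{cl}}_M$. An interior operation $\mathrm i$ on a class of modules assigns to each $M$ a submodule $\mathrm i(M)\subseteq M$, compatibly with isomorphisms, such that $L\subseteq M$ implies $\mathrm i(L)\subseteq\mathrm i(M)$, and $\mathrm i(\mathrm i(M))=\mathrm i(M)$. An interior operation on Artinian modules is Nakayama if whenever $A\subseteq B$ are Artinian with $\mathrm i(A:_B\mathfrak m)\subseteq A$, then $\mathrm i(A)=\mathrm i(B)$;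 here $(A:_B\mathfrak m)=\{b\in B:\mathfrak mb\subseteq A\}$. For $L\subseteq N\subseteq M$, $L$ is a $\mathrm{cl}$-reduction of $N$ in $M$ if $L^{\mathrm{cl}}_M=N^{\mathrm{cl}}_M$. The $\mathrm{cl}$-core $\mathrm{cl}\text{-core}_M(N)$ is the intersection of all $\mathrm{cl}$-reductions of $N$ in $M$. For $A\subseteq C\subseteq B$, $C$ is an $\mathrm i$-expansion of $A$ in $B$ if $\mathrm i(A)=\mathrm i(C)$. The $\mathrm i$-hull $\mathrm i\text{-hull}^B(A)$ is the sum of all $\mathrm i$-expansions of $A$ in $B$. *)

theory Defs
  imports "HOL-Algebra.Algebra"
begin

section \<open>Complete Noetherian local rings\<close>

definition local_ring :: "('a, 'r) ring_scheme \<Rightarrow> 'a set \<Rightarrow> bool" where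
  "local_ring R \<mm> \<longleftrightarrow> cring R \<and> maximalideal \<mm> R \<and> (\<forall>I. maximalideal I R \<longrightarrow> I = \<mm>)"

definition ideal_power :: "('a, 'r) ring_scheme \<Rightarrow> 'a set \<Rightarrow> nat \<Rightarrow> 'a set" where
  "ideal_power R I n = I [^]\<^bsub>ideals_set R\<^esub> n"

definition adically_complete :: "('a, 'r) ring_scheme \<Rightarrow> 'a set \<Rightarrow> bool" where
  "adically_complete R I \<longleftrightarrow>
     (\<Inter>n. ideal_power R I n) = {\<zero>\<^bsub>R\<^esub>} \<and>
     (\<forall>s :: nat \<Rightarrow> 'a. range s \<subseteq> carrier R \<longrightarrow>
        (\<forall>n. \<exists>k. \<forall>i\<ge>k. \<forall>j\<ge>k. s i \<ominus>\<^bsub>R\<^esub> s j \<in> ideal_power R I n) \<longrightarrow>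
        (\<exists>x\<in>carrier R. \<forall>n. \<exists>k. \<forall>i\<ge>k. s i \<ominus>\<^bsub>R\<^esub> x \<in> ideal_power R I n))"

definition complete_noetherian_local_ring :: "('a, 'r) ring_scheme \<Rightarrow> 'a set \<Rightarrow> bool" where
  "complete_noetherian_local_ring R \<mm> \<longleftrightarrow>
     local_ring R \<mm> \<and> noetherian_ring R \<and> adically_complete R \<mm>"


section \<open>Modules\<close>

text \<open>
  A submodule \<open>L\<close> of \<open>M\<close> is a set; regarded as a module it is \<open>M\<lparr>carrier := L\<rparr>\<close>.
  The record fields for multiplication and unit that modules inherit from rings carry no meaning.
\<close>

definition submodule_span :: "('a, 'r) ring_scheme \<Rightarrow> ('a, 'm) module \<Rightarrow> 'm set \<Rightarrow> 'm set" where
  "submodule_span R M S = \<Inter>{H. submodule H R M \<and> S \<subseteq> H}"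

definition submodule_sum :: "('a, 'r) ring_scheme \<Rightarrow> ('a, 'm) module \<Rightarrow> 'm set set \<Rightarrow> 'm set" where
  "submodule_sum R M F = submodule_span R M (\<Union>F)"

definition ideal_smult ::
    "('a, 'r) ring_scheme \<Rightarrow> ('a, 'm) module \<Rightarrow> 'a set \<Rightarrow> 'm set \<Rightarrow> 'm set" where
  "ideal_smult R M I N = submodule_span R M {r \<odot>\<^bsub>M\<^esub> x | r x. r \<in> I \<and> x \<in> N}"

definition submodule_colon :: "('a, 'm) module \<Rightarrow> 'm set \<Rightarrow> 'a set \<Rightarrow> 'm set" where
  "submodule_colon M L I = {x \<in> carrier M. \<forall>r\<in>I. r \<odot>\<^bsub>M\<^esub> x \<in> L}"

definition fg_modules :: "('a, 'r) ring_scheme \<Rightarrow> ('a, 'm) module set" where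
  "fg_modules R =
     {M. module R M \<and> (\<exists>S. finite S \<and> S \<subseteq> carrier M \<and> submodule_span R M S = carrier M)}"

definition artinian_modules :: "('a, 'r) ring_scheme \<Rightarrow> ('a, 'm) module set" where
  "artinian_modules R =
     {M. module R M \<and>
         (\<forall>H :: nat \<Rightarrow> 'm set. (\<forall>n. submodule (H n) R M \<and> H (Suc n) \<subseteq> H n) \<longrightarrow>
            (\<exists>n. \<forall>k\<ge>n. H k = H n))}"

text \<open>
  Homomorphisms are extensional (\<open>undefined\<close> outside the carrier), so that equality of
  homomorphisms is equality on the carrier.
\<close>

definition mod_hom ::
    "('a, 'r) ring_scheme \<Rightarrow> ('a, 'm) module \<Rightarrow> ('a, 'n) module \<Rightarrow> ('m \<Rightarrow> 'n) set" where
  "mod_hom R M N =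
     {f \<in> carrier M \<rightarrow>\<^sub>E carrier N.
        (\<forall>x\<in>carrier M. \<forall>y\<in>carrier M. f (x \<oplus>\<^bsub>M\<^esub> y) = f x \<oplus>\<^bsub>N\<^esub> f y) \<and>
        (\<forall>r\<in>carrier R. \<forall>x\<in>carrier M. f (r \<odot>\<^bsub>M\<^esub> x) = r \<odot>\<^bsub>N\<^esub> f x)}"


section \<open>The injective hull of the residue field\<close>

definition residue_module :: "('a, 'r) ring_scheme \<Rightarrow> 'a set \<Rightarrow> ('a, 'a set) module" where
  "residue_module R I =
     \<lparr>carrier = carrier (R Quot I),
      monoid.mult = (\<otimes>\<^bsub>R Quot I\<^esub>), monoid.one = \<one>\<^bsub>R Quot I\<^esub>,
      ring.zero = \<zero>\<^bsub>R Quot I\<^esub>, ring.add = (\<oplus>\<^bsub>R Quot I\<^esub>),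
      smult = (\<lambda>r x. (I +>\<^bsub>R\<^esub> r) \<otimes>\<^bsub>R Quot I\<^esub> x)\<rparr>"

text \<open>
  Injectivity quantifies over all modules, but a definition can only quantify over the modules
  carried by one type, here \<open>'n\<close>.  By \<open>injective_module_any_type\<close> below (Baer's criterion),
  injectivity relative to the type of the ring elements implies injectivity relative to every
  type; so this is the type chosen in \<open>injective_hull\<close>.
\<close>

definition injective_module ::
    "'n itself \<Rightarrow> ('a, 'r) ring_scheme \<Rightarrow> ('a, 'e) module \<Rightarrow> bool" where
  "injective_module _ R E \<longleftrightarrow> module R E \<and>
     (\<forall>(N :: ('a, 'n) module) L. module R N \<and> submodule L R N \<longrightarrow>
        (\<forall>f\<in>mod_hom R (N\<lparr>carrier := L\<rparr>) E. \<exists>g\<in>mod_hom R N E. \<forall>x\<in>L. g x = f x))"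

definition injective_hull ::
    "('a, 'r) ring_scheme \<Rightarrow> ('a, 'm) module \<Rightarrow> ('a, 'e) module \<Rightarrow> bool" where
  "injective_hull R M E \<longleftrightarrow> injective_module TYPE('a) R E \<and>
     (\<exists>j\<in>mod_hom R M E. inj_on j (carrier M) \<and>
        (\<forall>H. submodule H R E \<and> H \<noteq> {\<zero>\<^bsub>E\<^esub>} \<longrightarrow> H \<inter> j ` carrier M \<noteq> {\<zero>\<^bsub>E\<^esub>}))"

definition regular_module :: "('a, 'r) ring_scheme \<Rightarrow> ('a, 'a) module" where
  "regular_module R =
     \<lparr>carrier = carrier R, monoid.mult = (\<otimes>\<^bsub>R\<^esub>), monoid.one = \<one>\<^bsub>R\<^esub>,
      ring.zero = \<zero>\<^bsub>R\<^esub>, ring.add = (\<oplus>\<^bsub>R\<^esub>), smult = (\<otimes>\<^bsub>R\<^esub>)\<rparr>"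

lemma module_regular_module:
  assumes "cring R" shows "module R (regular_module R)"
proof -
  interpret R: cring R by fact
  show ?thesis
    unfolding regular_module_def
    by (rule moduleI)
       (auto intro!: abelian_groupI assms simp: R.l_distr R.r_distr R.m_assoc R.a_ac
          intro: R.l_neg)
qed

text \<open>Partial homomorphisms, represented by their graphs.\<close>

definition hom_graph ::
    "('a, 'r) ring_scheme \<Rightarrow> ('a, 'n) module \<Rightarrow> ('a, 'e) module \<Rightarrow> ('n \<times> 'e) set \<Rightarrow> bool" where
  "hom_graph R N E G \<longleftrightarrow> G \<subseteq> carrier N \<times> carrier E \<and>
     (\<forall>x y x' y'. (x, y) \<in> G \<longrightarrow> (x', y') \<in> G \<longrightarrow> (x \<oplus>\<^bsub>N\<^esub> x', y \<oplus>\<^bsub>E\<^esub> y') \<in> G) \<and>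
     (\<forall>r\<in>carrier R. \<forall>x y. (x, y) \<in> G \<longrightarrow> (r \<odot>\<^bsub>N\<^esub> x, r \<odot>\<^bsub>E\<^esub> y) \<in> G) \<and>
     (\<forall>x y y'. (x, y) \<in> G \<longrightarrow> (x, y') \<in> G \<longrightarrow> y = y')"

lemma hom_graph_total:
  assumes G: "hom_graph R N E G" and tot: "carrier N \<subseteq> fst ` G" and "module R N"
  shows "\<exists>g\<in>mod_hom R N E. \<forall>(x, y)\<in>G. g x = y"
proof -
  interpret N: module R N by fact
  have Ga: "\<And>u v u' v'. (u, v) \<in> G \<Longrightarrow> (u', v') \<in> G \<Longrightarrow> (u \<oplus>\<^bsub>N\<^esub> u', v \<oplus>\<^bsub>E\<^esub> v') \<in> G"
    and Gs: "\<And>r u v. r \<in> carrier R \<Longrightarrow> (u, v) \<in> G \<Longrightarrow> (r \<odot>\<^bsub>N\<^esub> u, r \<odot>\<^bsub>E\<^esub> v) \<in> G"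
    using G unfolding hom_graph_def by blast+
  define g where "g = (\<lambda>x\<in>carrier N. THE y. (x, y) \<in> G)"
  have g: "g x = y" if "(x, y) \<in> G" for x y
  proof -
    have "x \<in> carrier N" and "\<And>y'. (x, y') \<in> G \<Longrightarrow> y' = y"
      using that G unfolding hom_graph_def by blast+
    moreover from that this(2) have "(THE y. (x, y) \<in> G) = y" by (rule the_equality)
    ultimately show ?thesis by (simp add: g_def)
  qed
  have gG: "(x, g x) \<in> G" if "x \<in> carrier N" for x
    using tot that g by force
  have "g \<in> mod_hom R N E"
    unfolding mod_hom_def
  proof (intro CollectI conjI ballI)
    show "g \<in> carrier N \<rightarrow>\<^sub>E carrier E"
      using gG G unfolding hom_graph_def g_def by (auto simp: PiE_iff extensional_def)
  next
    fix x y assume "x \<in> carrier N" "y \<in> carrier N"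
    then show "g (x \<oplus>\<^bsub>N\<^esub> y) = g x \<oplus>\<^bsub>E\<^esub> g y"
      by (intro g Ga gG)
  next
    fix r x assume "r \<in> carrier R" "x \<in> carrier N"
    then show "g (r \<odot>\<^bsub>N\<^esub> x) = r \<odot>\<^bsub>E\<^esub> g x"
      by (intro g Gs gG)
  qed
  with g show ?thesis by auto
qed

lemma hom_graph_extend:
  fixes R :: "('a, 'r) ring_scheme"
  assumes inj: "injective_module TYPE('a) R E" and N: "module R N"
    and G: "hom_graph R N E G" and z: "(\<zero>\<^bsub>N\<^esub>, \<zero>\<^bsub>E\<^esub>) \<in> G" and x: "x \<in> carrier N"
  shows "\<exists>G' y. hom_graph R N E G' \<and> G \<subseteq> G' \<and> (x, y) \<in> G'"
proof -
  interpret N: module R N by fact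
  interpret E: module R E using inj by (simp add: injective_module_def)
  have Gc: "\<And>u v. (u, v) \<in> G \<Longrightarrow> u \<in> carrier N \<and> v \<in> carrier E"
    and Ga: "\<And>u v u' v'. (u, v) \<in> G \<Longrightarrow> (u', v') \<in> G \<Longrightarrow> (u \<oplus>\<^bsub>N\<^esub> u', v \<oplus>\<^bsub>E\<^esub> v') \<in> G"
    and Gs: "\<And>r u v. r \<in> carrier R \<Longrightarrow> (u, v) \<in> G \<Longrightarrow> (r \<odot>\<^bsub>N\<^esub> u, r \<odot>\<^bsub>E\<^esub> v) \<in> G"
    and Gu: "\<And>u v v'. (u, v) \<in> G \<Longrightarrow> (u, v') \<in> G \<Longrightarrow> v = v'"
    using G unfolding hom_graph_def by blast+
  have Gm: "(\<ominus>\<^bsub>N\<^esub> u, \<ominus>\<^bsub>E\<^esub> v) \<in> G" if "(u, v) \<in> G" for u v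
    using Gs[OF _ that, of "\<ominus>\<^bsub>R\<^esub> \<one>\<^bsub>R\<^esub>"] Gc[OF that]
    by (simp add: N.smult_l_minus E.smult_l_minus)
  define I where "I = {r \<in> carrier R. \<exists>v. (r \<odot>\<^bsub>N\<^esub> x, v) \<in> G}"
  define \<phi> where "\<phi> = (\<lambda>r\<in>I. THE v. (r \<odot>\<^bsub>N\<^esub> x, v) \<in> G)"
  have \<phi>: "\<phi> r = v" if "r \<in> carrier R" "(r \<odot>\<^bsub>N\<^esub> x, v) \<in> G" for r v
    using that Gu unfolding \<phi>_def I_def by (auto intro!: the_equality)
  have \<phi>G: "(r \<odot>\<^bsub>N\<^esub> x, \<phi> r) \<in> G" if "r \<in> I" for r
    using that \<phi> unfolding I_def by auto
  have IR: "I \<subseteq> carrier R" by (auto simp: I_def)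
  have add: "(((r \<oplus>\<^bsub>R\<^esub> s) \<odot>\<^bsub>N\<^esub> x), \<phi> r \<oplus>\<^bsub>E\<^esub> \<phi> s) \<in> G" if "r \<in> I" "s \<in> I" for r s
    using Ga[OF \<phi>G \<phi>G, OF that] that IR x by (simp add: N.smult_l_distr subset_iff)
  have sm: "(((r \<otimes>\<^bsub>R\<^esub> s) \<odot>\<^bsub>N\<^esub> x), r \<odot>\<^bsub>E\<^esub> \<phi> s) \<in> G" if "r \<in> carrier R" "s \<in> I" for r s
    using Gs[OF that(1) \<phi>G, OF that(2)] that IR x by (simp add: N.smult_assoc1 subset_iff)
  interpret RR: module R "regular_module R" by (rule module_regular_module) (rule N.R.is_cring)
  have RRs: "carrier (regular_module R) = carrier R" "\<zero>\<^bsub>regular_module R\<^esub> = \<zero>\<^bsub>R\<^esub>"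
    "\<And>a b. a \<oplus>\<^bsub>regular_module R\<^esub> b = a \<oplus>\<^bsub>R\<^esub> b" "\<And>a b. a \<odot>\<^bsub>regular_module R\<^esub> b = a \<otimes>\<^bsub>R\<^esub> b"
    by (simp_all add: regular_module_def)
  have Iadd: "r \<oplus>\<^bsub>R\<^esub> s \<in> I" if "r \<in> I" "s \<in> I" for r s
    using add[OF that] that IR by (auto simp: I_def)
  have Ism: "r \<otimes>\<^bsub>R\<^esub> s \<in> I" if "r \<in> carrier R" "s \<in> I" for r s
    using sm[OF that] that IR by (auto simp: I_def)
  have I0: "\<zero>\<^bsub>R\<^esub> \<in> I" using z x by (auto simp: I_def)
  have "submodule I R (regular_module R)"
  proof (rule RR.submoduleI)
    fix a assume a: "a \<in> I"
    have "\<ominus>\<^bsub>regular_module R\<^esub> a = (\<ominus>\<^bsub>R\<^esub> \<one>\<^bsub>R\<^esub>) \<otimes>\<^bsub>R\<^esub> a"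
      using RR.smult_l_minus[of "\<one>\<^bsub>R\<^esub>" a] a IR by (auto simp: RRs subset_iff)
    then show "\<ominus>\<^bsub>regular_module R\<^esub> a \<in> I" using Ism[OF _ a] by simp
  qed (use Iadd Ism IR I0 in \<open>auto simp: RRs\<close>)
  moreover have "\<phi> \<in> mod_hom R (regular_module R\<lparr>carrier := I\<rparr>) E"
    unfolding mod_hom_def
  proof (intro CollectI conjI ballI, goal_cases)
    case 1
    show ?case using \<phi>G Gc by (fastforce simp: PiE_iff extensional_def \<phi>_def[THEN fun_cong])
  next
    case (2 r s)
    then show ?case using \<phi>[OF _ add, of r s] IR by (auto simp: RRs)
  next
    case (3 r s)
    then show ?case using \<phi>[OF _ sm, of r s] IR by (auto simp: RRs)
  qed
  ultimately obtain g where g: "g \<in> mod_hom R (regular_module R) E" "\<And>r. r \<in> I \<Longrightarrow> g r = \<phi> r"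
    using inj RR.module_axioms unfolding injective_module_def by blast
  define e where "e = g \<one>\<^bsub>R\<^esub>"
  have e: "e \<in> carrier E" using g(1) by (auto simp: e_def mod_hom_def RRs PiE_iff)
  have ge: "\<phi> r = r \<odot>\<^bsub>E\<^esub> e" if "r \<in> I" for r
  proof -
    have "g (r \<otimes>\<^bsub>R\<^esub> \<one>\<^bsub>R\<^esub>) = r \<odot>\<^bsub>E\<^esub> e"
      using g(1) that IR N.R.one_closed unfolding e_def mod_hom_def RRs by blast
    then show ?thesis using g(2)[OF that] that IR by (auto simp: subset_iff)
  qed
  have key: "v = r \<odot>\<^bsub>E\<^esub> e" if "r \<in> carrier R" "(r \<odot>\<^bsub>N\<^esub> x, v) \<in> G" for r v
    using ge[of r] \<phi>[OF that] that by (auto simp: I_def)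
  define G' where "G' = {(u \<oplus>\<^bsub>N\<^esub> r \<odot>\<^bsub>N\<^esub> x, v \<oplus>\<^bsub>E\<^esub> r \<odot>\<^bsub>E\<^esub> e) | u v r. (u, v) \<in> G \<and> r \<in> carrier R}"
  have "hom_graph R N E G'"
    unfolding hom_graph_def
  proof (intro conjI allI impI ballI)
    show "G' \<subseteq> carrier N \<times> carrier E" using Gc x e by (auto simp: G'_def)
  next
    fix a b a' b' assume "(a, b) \<in> G'" "(a', b') \<in> G'"
    then obtain u v r u' v' r' where *: "(u, v) \<in> G" "r \<in> carrier R" "(u', v') \<in> G" "r' \<in> carrier R"
      "a = u \<oplus>\<^bsub>N\<^esub> r \<odot>\<^bsub>N\<^esub> x" "b = v \<oplus>\<^bsub>E\<^esub> r \<odot>\<^bsub>E\<^esub> e" "a' = u' \<oplus>\<^bsub>N\<^esub> r' \<odot>\<^bsub>N\<^esub> x" "b' = v' \<oplus>\<^bsub>E\<^esub> r' \<odot>\<^bsub>E\<^esub> e"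
      unfolding G'_def by blast
    have "a \<oplus>\<^bsub>N\<^esub> a' = (u \<oplus>\<^bsub>N\<^esub> u') \<oplus>\<^bsub>N\<^esub> (r \<oplus>\<^bsub>R\<^esub> r') \<odot>\<^bsub>N\<^esub> x"
      "b \<oplus>\<^bsub>E\<^esub> b' = (v \<oplus>\<^bsub>E\<^esub> v') \<oplus>\<^bsub>E\<^esub> (r \<oplus>\<^bsub>R\<^esub> r') \<odot>\<^bsub>E\<^esub> e"
      using * Gc[OF *(1)] Gc[OF *(3)] x e
      by (simp_all add: N.smult_l_distr E.smult_l_distr N.M.a_ac E.M.a_ac)
    then show "(a \<oplus>\<^bsub>N\<^esub> a', b \<oplus>\<^bsub>E\<^esub> b') \<in> G'"
      unfolding G'_def using Ga[OF *(1,3)] *(2,4) by blast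
  next
    fix s a b assume s: "s \<in> carrier R" and "(a, b) \<in> G'"
    then obtain u v r where *: "(u, v) \<in> G" "r \<in> carrier R"
      "a = u \<oplus>\<^bsub>N\<^esub> r \<odot>\<^bsub>N\<^esub> x" "b = v \<oplus>\<^bsub>E\<^esub> r \<odot>\<^bsub>E\<^esub> e"
      unfolding G'_def by blast
    have "s \<odot>\<^bsub>N\<^esub> a = s \<odot>\<^bsub>N\<^esub> u \<oplus>\<^bsub>N\<^esub> (s \<otimes>\<^bsub>R\<^esub> r) \<odot>\<^bsub>N\<^esub> x"
      "s \<odot>\<^bsub>E\<^esub> b = s \<odot>\<^bsub>E\<^esub> v \<oplus>\<^bsub>E\<^esub> (s \<otimes>\<^bsub>R\<^esub> r) \<odot>\<^bsub>E\<^esub> e"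
      using * Gc[OF *(1)] x e s
      by (simp_all add: N.smult_r_distr E.smult_r_distr N.smult_assoc1 E.smult_assoc1)
    then show "(s \<odot>\<^bsub>N\<^esub> a, s \<odot>\<^bsub>E\<^esub> b) \<in> G'"
      unfolding G'_def using Gs[OF s *(1)] *(2) s by blast
  next
    fix a b b' assume "(a, b) \<in> G'" "(a, b') \<in> G'"
    then obtain u v r u' v' r' where *: "(u, v) \<in> G" "r \<in> carrier R" "(u', v') \<in> G" "r' \<in> carrier R"
      "a = u \<oplus>\<^bsub>N\<^esub> r \<odot>\<^bsub>N\<^esub> x" "b = v \<oplus>\<^bsub>E\<^esub> r \<odot>\<^bsub>E\<^esub> e" "a = u' \<oplus>\<^bsub>N\<^esub> r' \<odot>\<^bsub>N\<^esub> x" "b' = v' \<oplus>\<^bsub>E\<^esub> r' \<odot>\<^bsub>E\<^esub> e"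
      unfolding G'_def by blast
    note c = Gc[OF *(1)] Gc[OF *(3)] *(2,4) x e
    have eq: "u \<oplus>\<^bsub>N\<^esub> r \<odot>\<^bsub>N\<^esub> x = u' \<oplus>\<^bsub>N\<^esub> r' \<odot>\<^bsub>N\<^esub> x" using * by simp
    have "(r \<ominus>\<^bsub>R\<^esub> r') \<odot>\<^bsub>N\<^esub> x = r \<odot>\<^bsub>N\<^esub> x \<ominus>\<^bsub>N\<^esub> r' \<odot>\<^bsub>N\<^esub> x"
      using c by (simp add: a_minus_def N.smult_l_distr N.smult_l_minus)
    also have "\<dots> = \<ominus>\<^bsub>N\<^esub> u \<oplus>\<^bsub>N\<^esub> (u \<oplus>\<^bsub>N\<^esub> r \<odot>\<^bsub>N\<^esub> x) \<ominus>\<^bsub>N\<^esub> r' \<odot>\<^bsub>N\<^esub> x"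
      using c by (simp add: N.M.r_neg1)
    also have "\<dots> = \<ominus>\<^bsub>N\<^esub> u \<oplus>\<^bsub>N\<^esub> (u' \<oplus>\<^bsub>N\<^esub> r' \<odot>\<^bsub>N\<^esub> x) \<ominus>\<^bsub>N\<^esub> r' \<odot>\<^bsub>N\<^esub> x"
      by (simp only: eq)
    also have "\<dots> = u' \<oplus>\<^bsub>N\<^esub> \<ominus>\<^bsub>N\<^esub> u"
      using c by (simp add: a_minus_def N.M.a_ac N.M.r_neg)
    finally have "((r \<ominus>\<^bsub>R\<^esub> r') \<odot>\<^bsub>N\<^esub> x, v' \<oplus>\<^bsub>E\<^esub> \<ominus>\<^bsub>E\<^esub> v) \<in> G"
      using Ga[OF *(3) Gm[OF *(1)]] by simp
    then have k: "v' \<oplus>\<^bsub>E\<^esub> \<ominus>\<^bsub>E\<^esub> v = (r \<ominus>\<^bsub>R\<^esub> r') \<odot>\<^bsub>E\<^esub> e"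
      using key c by simp
    have "b' = v \<oplus>\<^bsub>E\<^esub> (v' \<oplus>\<^bsub>E\<^esub> \<ominus>\<^bsub>E\<^esub> v) \<oplus>\<^bsub>E\<^esub> r' \<odot>\<^bsub>E\<^esub> e"
      using c * by (simp add: E.M.a_ac E.M.r_neg E.M.r_neg1 E.M.r_neg2)
    also have "\<dots> = v \<oplus>\<^bsub>E\<^esub> ((r \<ominus>\<^bsub>R\<^esub> r') \<oplus>\<^bsub>R\<^esub> r') \<odot>\<^bsub>E\<^esub> e"
      unfolding k using c by (simp add: E.smult_l_distr E.M.a_assoc)
    also have "(r \<ominus>\<^bsub>R\<^esub> r') \<oplus>\<^bsub>R\<^esub> r' = r"
      using c by (simp add: a_minus_def N.R.a_assoc N.R.l_neg)
    finally show "b = b'" using * by simp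
  qed
  moreover have "G \<subseteq> G'"
  proof
    fix p assume p: "p \<in> G"
    obtain u v where uv: "p = (u, v)" by (cases p)
    have "p = (u \<oplus>\<^bsub>N\<^esub> \<zero>\<^bsub>R\<^esub> \<odot>\<^bsub>N\<^esub> x, v \<oplus>\<^bsub>E\<^esub> \<zero>\<^bsub>R\<^esub> \<odot>\<^bsub>E\<^esub> e)"
      using Gc p x e uv by simp
    moreover have "(u, v) \<in> G" "\<zero>\<^bsub>R\<^esub> \<in> carrier R" using p uv by simp_all
    ultimately show "p \<in> G'" unfolding G'_def by blast
  qed
  moreover have "(x, e) \<in> G'"
  proof -
    have "(x, e) = (\<zero>\<^bsub>N\<^esub> \<oplus>\<^bsub>N\<^esub> \<one>\<^bsub>R\<^esub> \<odot>\<^bsub>N\<^esub> x, \<zero>\<^bsub>E\<^esub> \<oplus>\<^bsub>E\<^esub> \<one>\<^bsub>R\<^esub> \<odot>\<^bsub>E\<^esub> e)"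
      using x e by simp
    with z show ?thesis unfolding G'_def using N.R.one_closed by blast
  qed
  ultimately show ?thesis by blast
qed

lemma injective_module_any_type:
  fixes R :: "('a, 'r) ring_scheme"
  assumes inj: "injective_module TYPE('a) R E"
  shows "injective_module TYPE('n) R E"
  unfolding injective_module_def
proof (intro conjI allI impI ballI)
  show E: "module R E" using inj by (simp add: injective_module_def)
  interpret E: module R E by fact
  fix N :: "('a, 'n) module" and L f
  assume "module R N \<and> submodule L R N" and f: "f \<in> mod_hom R (N\<lparr>carrier := L\<rparr>) E"
  then have N: "module R N" and L: "submodule L R N" by auto
  interpret N: module R N by fact
  note LE = N.submoduleE[OF L]
  have L0: "\<zero>\<^bsub>N\<^esub> \<in> L" using L by (simp add: submodule_def subgroup_def)
  define F where "F = {(x, f x) | x. x \<in> L}"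
  have fadd: "f (x \<oplus>\<^bsub>N\<^esub> y) = f x \<oplus>\<^bsub>E\<^esub> f y" if "x \<in> L" "y \<in> L" for x y
    using f that by (simp add: mod_hom_def)
  have fsm: "f (r \<odot>\<^bsub>N\<^esub> x) = r \<odot>\<^bsub>E\<^esub> f x" if "r \<in> carrier R" "x \<in> L" for r x
    using f that by (simp add: mod_hom_def)
  have fc: "f x \<in> carrier E" if "x \<in> L" for x
    using f that by (auto simp: mod_hom_def)
  have F: "hom_graph R N E F"
    unfolding hom_graph_def F_def using LE fadd fsm fc by fastforce
  have "f \<zero>\<^bsub>N\<^esub> = \<zero>\<^bsub>E\<^esub>" using fsm[of "\<zero>\<^bsub>R\<^esub>" "\<zero>\<^bsub>N\<^esub>"] fc L0 by simp
  then have zF: "(\<zero>\<^bsub>N\<^esub>, \<zero>\<^bsub>E\<^esub>) \<in> F" using L0 by (force simp: F_def)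
  define \<A> where "\<A> = {G. hom_graph R N E G \<and> F \<subseteq> G}"
  have "\<exists>G\<in>\<A>. \<forall>K\<in>\<A>. G \<subseteq> K \<longrightarrow> K = G"
  proof (rule subset_Zorn_nonempty)
    show "\<A> \<noteq> {}" using F by (auto simp: \<A>_def)
  next
    fix \<C> assume ne: "\<C> \<noteq> {}" and ch: "subset.chain \<A> \<C>"
    have sub: "\<And>G. G \<in> \<C> \<Longrightarrow> hom_graph R N E G \<and> F \<subseteq> G"
      using ch by (auto simp: subset.chain_def \<A>_def)
    have two: "\<exists>G\<in>\<C>. p \<in> G \<and> q \<in> G" if "p \<in> \<Union>\<C>" "q \<in> \<Union>\<C>" for p q
    proof -
      from that obtain G H where GH: "G \<in> \<C>" "p \<in> G" "H \<in> \<C>" "q \<in> H" by blast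
      then have "G \<subseteq> H \<or> H \<subseteq> G" using ch by (auto simp: subset_chain_def)
      then show ?thesis using GH by blast
    qed
    have "hom_graph R N E (\<Union>\<C>)"
      unfolding hom_graph_def
    proof (intro conjI allI impI ballI)
      show "\<Union>\<C> \<subseteq> carrier N \<times> carrier E" using sub unfolding hom_graph_def by blast
    next
      fix x y x' y' assume "(x, y) \<in> \<Union>\<C>" "(x', y') \<in> \<Union>\<C>"
      then obtain G where "G \<in> \<C>" "(x, y) \<in> G" "(x', y') \<in> G" using two by blast
      then show "(x \<oplus>\<^bsub>N\<^esub> x', y \<oplus>\<^bsub>E\<^esub> y') \<in> \<Union>\<C>" using sub unfolding hom_graph_def by blast
    next
      fix r x y assume "r \<in> carrier R" "(x, y) \<in> \<Union>\<C>"
      then show "(r \<odot>\<^bsub>N\<^esub> x, r \<odot>\<^bsub>E\<^esub> y) \<in> \<Union>\<C>" using sub unfolding hom_graph_def by blast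
    next
      fix x y y' assume "(x, y) \<in> \<Union>\<C>" "(x, y') \<in> \<Union>\<C>"
      then obtain G where "G \<in> \<C>" "(x, y) \<in> G" "(x, y') \<in> G" using two by blast
      then show "y = y'" using sub unfolding hom_graph_def by blast
    qed
    then show "\<Union>\<C> \<in> \<A>" using ne sub by (auto simp: \<A>_def)
  qed
  then obtain G where GA: "G \<in> \<A>" and max\<A>: "\<forall>K\<in>\<A>. G \<subseteq> K \<longrightarrow> K = G" ..
  have G: "hom_graph R N E G" "F \<subseteq> G" using GA by (auto simp: \<A>_def)
  have max: "K = G" if "hom_graph R N E K" "G \<subseteq> K" for K
    using max\<A> G(2) that by (simp add: \<A>_def)
  have "carrier N \<subseteq> fst ` G"
  proof
    fix x assume "x \<in> carrier N"
    moreover have "(\<zero>\<^bsub>N\<^esub>, \<zero>\<^bsub>E\<^esub>) \<in> G" using zF G(2) by blast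
    ultimately obtain G' y where "hom_graph R N E G'" "G \<subseteq> G'" "(x, y) \<in> G'"
      using hom_graph_extend[OF inj N G(1)] by blast
    then have "(x, y) \<in> G" using max[of G'] by simp
    then show "x \<in> fst ` G" by (rule rev_image_eqI) simp
  qed
  from hom_graph_total[OF G(1) this N] obtain g where
    g: "g \<in> mod_hom R N E" "\<forall>(x, y)\<in>G. g x = y" by blast
  have "g x = f x" if "x \<in> L" for x
  proof -
    have "(x, f x) \<in> G" using G(2) that by (auto simp: F_def)
    then show ?thesis using g(2) by auto
  qed
  then show "\<exists>g\<in>mod_hom R N E. \<forall>x\<in>L. g x = f x" using g(1) by auto
qed


section \<open>Matlis duality\<close>

definition matlis_dual ::
    "('a, 'r) ring_scheme \<Rightarrow> ('a, 'e) module \<Rightarrow> ('a, 'm) module \<Rightarrow> ('a, 'm \<Rightarrow> 'e) module" where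
  "matlis_dual R E M =
     \<lparr>carrier = mod_hom R M E,
      monoid.mult = undefined, monoid.one = undefined,
      ring.zero = (\<lambda>x\<in>carrier M. \<zero>\<^bsub>E\<^esub>),
      ring.add = (\<lambda>f g. \<lambda>x\<in>carrier M. f x \<oplus>\<^bsub>E\<^esub> g x),
      smult = (\<lambda>r f. \<lambda>x\<in>carrier M. r \<odot>\<^bsub>E\<^esub> f x)\<rparr>"

text \<open>\<open>(M/L)\<^sup>\<or>\<close> as a submodule of \<open>M\<^sup>\<or>\<close>\<close>

definition dual_of_quotient ::
    "('a, 'r) ring_scheme \<Rightarrow> ('a, 'e) module \<Rightarrow> ('a, 'm) module \<Rightarrow> 'm set \<Rightarrow> ('m \<Rightarrow> 'e) set" where
  "dual_of_quotient R E M L =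
     {f \<in> carrier (matlis_dual R E M). \<forall>x\<in>L. f x = \<zero>\<^bsub>E\<^esub>}"

definition biduality_map ::
    "('a, 'r) ring_scheme \<Rightarrow> ('a, 'e) module \<Rightarrow> ('a, 'm) module \<Rightarrow> 'm \<Rightarrow> ('m \<Rightarrow> 'e) \<Rightarrow> 'e" where
  "biduality_map R E M x = (\<lambda>f\<in>carrier (matlis_dual R E M). f x)"

text \<open>
  For \<open>L \<subseteq> B\<^sup>\<or>\<close>, the module \<open>(B\<^sup>\<or>/L)\<^sup>\<or>\<close> as a submodule of \<open>B\<close>: pull the submodule
  \<open>(B\<^sup>\<or>/L)\<^sup>\<or>\<close> of the bidual back along the biduality map.
\<close>

definition dual_of_dual_quotient ::
    "('a, 'r) ring_scheme \<Rightarrow> ('a, 'e) module \<Rightarrow> ('a, 'b) module \<Rightarrow> ('b \<Rightarrow> 'e) set \<Rightarrow> 'b set" where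
  "dual_of_dual_quotient R E B L =
     {b \<in> carrier B. biduality_map R E B b \<in> dual_of_quotient R E (matlis_dual R E B) L}"


section \<open>Closure operations\<close>

text \<open>
  A closure operation maps a module \<open>M\<close> of the class and a submodule \<open>L\<close> of it to the closure
  of \<open>L\<close> in \<open>M\<close>; its values elsewhere are irrelevant.  A class consists of modules carried by one
  type.  Such classes are closed under quotients up to isomorphism, as \<open>M/L\<close> can be carried by a
  system of coset representatives, and quotients enter below only as surjections \<open>M \<rightarrow> P\<close>.
\<close>

definition closure_operation ::
    "('a, 'r) ring_scheme \<Rightarrow> ('a, 'm) module set \<Rightarrow> (('a, 'm) module \<Rightarrow> 'm set \<Rightarrow> 'm set) \<Rightarrow> bool"
  where
  "closure_operation R \<M> cl \<longleftrightarrow>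
     (\<forall>M\<in>\<M>. \<forall>L. submodule L R M \<longrightarrow>
        submodule (cl M L) R M \<and> L \<subseteq> cl M L \<and> cl M (cl M L) = cl M L) \<and>
     (\<forall>M\<in>\<M>. \<forall>L N. submodule L R M \<and> submodule N R M \<and> L \<subseteq> N \<longrightarrow> cl M L \<subseteq> cl M N)"

definition residual ::
    "('a, 'r) ring_scheme \<Rightarrow> ('a, 'm) module set \<Rightarrow> (('a, 'm) module \<Rightarrow> 'm set \<Rightarrow> 'm set) \<Rightarrow> bool"
  where
  "residual R \<M> cl \<longleftrightarrow>
     (\<forall>M\<in>\<M>. \<forall>P\<in>\<M>. \<forall>q\<in>mod_hom R M P. q ` carrier M = carrier P \<longrightarrow>
        cl M {x \<in> carrier M. q x = \<zero>\<^bsub>P\<^esub>} = {x \<in> carrier M. q x \<in> cl P {\<zero>\<^bsub>P\<^esub>}})"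

definition nakayama_closure ::
    "('a, 'r) ring_scheme \<Rightarrow> 'a set \<Rightarrow> (('a, 'm) module \<Rightarrow> 'm set \<Rightarrow> 'm set) \<Rightarrow> bool" where
  "nakayama_closure R \<mm> cl \<longleftrightarrow>
     (\<forall>M\<in>fg_modules R. \<forall>L N. submodule L R M \<and> submodule N R M \<and> L \<subseteq> N \<and>
        M\<lparr>carrier := L\<rparr> \<in> fg_modules R \<and> M\<lparr>carrier := N\<rparr> \<in> fg_modules R \<and>
        N \<subseteq> cl M (L <+>\<^bsub>M\<^esub> ideal_smult R M \<mm> N) \<longrightarrow>
        cl M L = cl M N)"

definition cl_reductions ::
    "('a, 'r) ring_scheme \<Rightarrow> (('a, 'm) module \<Rightarrow> 'm set \<Rightarrow> 'm set) \<Rightarrow>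
     ('a, 'm) module \<Rightarrow> 'm set \<Rightarrow> 'm set set" where
  "cl_reductions R cl M N = {L. submodule L R M \<and> L \<subseteq> N \<and> cl M L = cl M N}"

definition cl_core ::
    "('a, 'r) ring_scheme \<Rightarrow> (('a, 'm) module \<Rightarrow> 'm set \<Rightarrow> 'm set) \<Rightarrow>
     ('a, 'm) module \<Rightarrow> 'm set \<Rightarrow> 'm set" where
  "cl_core R cl M N = \<Inter>(cl_reductions R cl M N)"


section \<open>Interior operations\<close>

definition interior_operation ::
    "('a, 'r) ring_scheme \<Rightarrow> ('a, 'm) module set \<Rightarrow> (('a, 'm) module \<Rightarrow> 'm set) \<Rightarrow> bool" where
  "interior_operation R \<M> i \<longleftrightarrow>
     (\<forall>M\<in>\<M>. submodule (i M) R M) \<and>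
     (\<forall>M\<in>\<M>. \<forall>N\<in>\<M>. \<forall>\<phi>\<in>mod_hom R M N. bij_betw \<phi> (carrier M) (carrier N) \<longrightarrow> \<phi> ` i M = i N) \<and>
     (\<forall>M\<in>\<M>. \<forall>L. submodule L R M \<longrightarrow> i (M\<lparr>carrier := L\<rparr>) \<subseteq> i M) \<and>
     (\<forall>M\<in>\<M>. i (M\<lparr>carrier := i M\<rparr>) = i M)"

definition nakayama_interior ::
    "('a, 'r) ring_scheme \<Rightarrow> 'a set \<Rightarrow> (('a, 'm) module \<Rightarrow> 'm set) \<Rightarrow> bool" where
  "nakayama_interior R \<mm> i \<longleftrightarrow>
     (\<forall>B\<in>artinian_modules R. \<forall>A. submodule A R B \<and>
        i (B\<lparr>carrier := submodule_colon B A \<mm>\<rparr>) \<subseteq> A \<longrightarrow> i (B\<lparr>carrier := A\<rparr>) = i B)"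

definition i_expansions ::
    "('a, 'r) ring_scheme \<Rightarrow> (('a, 'm) module \<Rightarrow> 'm set) \<Rightarrow>
     ('a, 'm) module \<Rightarrow> 'm set \<Rightarrow> 'm set set" where
  "i_expansions R i B A =
     {C. submodule C R B \<and> A \<subseteq> C \<and> i (B\<lparr>carrier := A\<rparr>) = i (B\<lparr>carrier := C\<rparr>)}"

definition i_hull ::
    "('a, 'r) ring_scheme \<Rightarrow> (('a, 'm) module \<Rightarrow> 'm set) \<Rightarrow>
     ('a, 'm) module \<Rightarrow> 'm set \<Rightarrow> 'm set" where
  "i_hull R i B A = submodule_sum R B (i_expansions R i B A)"

text \<open>
  For Artinian modules carried by \<open>'b\<close> and \<open>E\<close> carried by \<open>'e\<close>, the Matlis duals are carried by
  \<open>'b \<Rightarrow> 'e\<close>; hence the closure operation to be dualized lives on the finitely generated modules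
  carried by that type.  Every closure operation on all finitely generated modules restricts
  to such a one, and \<open>'b\<close> is arbitrary.
\<close>

definition dual_interior ::
    "('a, 'r) ring_scheme \<Rightarrow> ('a, 'e) module \<Rightarrow>
     (('a, 'b \<Rightarrow> 'e) module \<Rightarrow> ('b \<Rightarrow> 'e) set \<Rightarrow> ('b \<Rightarrow> 'e) set) \<Rightarrow> ('a, 'b) module \<Rightarrow> 'b set" where
  "dual_interior R E cl A =
     dual_of_dual_quotient R E A (cl (matlis_dual R E A) {\<zero>\<^bsub>matlis_dual R E A\<^esub>})"

end

theory Submission
  imports Defs
begin

text \<open>
  Everything rests on Matlis duality for an Artinian module \<open>B\<close>: taking annihilators is an
  order-reversing bijection between the submodules of \<open>B\<close> and those of \<open>B\<^sup>\<or>\<close>, all of which are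
  finitely generated.  For \<open>L \<subseteq> B\<^sup>\<or>\<close> the descending chain condition gives a finite \<open>S \<subseteq> L\<close> with the
  same annihilator in \<open>B\<close>; a map \<open>f\<close> vanishing there is an \<open>R\<close>-combination of \<open>S\<close>, because
  endomorphisms of \<open>E\<close> are multiplications by elements of the complete ring \<open>R\<close>.

  Under this bijection residuality turns into \<open>ann (i(A)) = cl (ann A)\<close> for all \<open>A \<subseteq> B\<close>, and \<open>(A : \<mm>)\<close>
  corresponds to \<open>\<mm> ann A\<close>; so the interior axioms, the Nakayama property, and (1) and (3) are
  translations.  For (2), let \<open>U\<close> be the union of a chain of expansions of \<open>A\<close>.  Since \<open>(A : \<mm>)/A\<close> is
  a finite-dimensional vector space over the residue field, \<open>U \<inter> (A : \<mm>)\<close> is already contained in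
  some member of the chain, so the Nakayama property in \<open>U\<close> gives \<open>i(A) = i(U)\<close>, and Zorn's lemma
  applies.
\<close>

section \<open>Submodules\<close>

lemma (in abelian_group) eq_of_minus_eq_zero:
  assumes "x \<ominus> y = \<zero>" "x \<in> carrier G" "y \<in> carrier G"
  shows "x = y"
  using minus_equality[of x "\<ominus> y"] assms by (simp add: a_minus_def)

lemma (in module) smult_left_commute:
  assumes "a \<in> carrier R" "b \<in> carrier R" "x \<in> carrier M"
  shows "a \<odot>\<^bsub>M\<^esub> (b \<odot>\<^bsub>M\<^esub> x) = b \<odot>\<^bsub>M\<^esub> (a \<odot>\<^bsub>M\<^esub> x)"
  using assms by (metis R.m_comm smult_assoc1)

lemma (in module) submodule_iff:
  "submodule H R M \<longleftrightarrow> H \<subseteq> carrier M \<and> \<zero>\<^bsub>M\<^esub> \<in> H \<and>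
     (\<forall>a\<in>H. \<forall>b\<in>H. a \<oplus>\<^bsub>M\<^esub> b \<in> H) \<and> (\<forall>r\<in>carrier R. \<forall>a\<in>H. r \<odot>\<^bsub>M\<^esub> a \<in> H)"
  (is "_ \<longleftrightarrow> ?rhs")
proof
  assume H: "submodule H R M"
  have "\<zero>\<^bsub>M\<^esub> \<in> H"
    using H by (simp add: submodule_def subgroup_def)
  then show ?rhs using submoduleE[OF H] by auto
next
  assume H: ?rhs
  have "\<ominus>\<^bsub>M\<^esub> a \<in> H" if "a \<in> H" for a
  proof -
    have "\<ominus>\<^bsub>M\<^esub> a = (\<ominus>\<^bsub>R\<^esub> \<one>\<^bsub>R\<^esub>) \<odot>\<^bsub>M\<^esub> a"
      using smult_l_minus[of "\<one>\<^bsub>R\<^esub>" a] H that by auto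
    then show ?thesis using H that by auto
  qed
  then show "submodule H R M" using H by (intro submoduleI) auto
qed

lemma submodule_restrict_iff:
  assumes "module R M" "submodule L R M"
  shows "submodule H R (M\<lparr>carrier := L\<rparr>) \<longleftrightarrow> submodule H R M \<and> H \<subseteq> L"
proof -
  have "module R (M\<lparr>carrier := L\<rparr>)"
    using submodule.submodule_is_module[OF assms(2,1)] .
  then show ?thesis
    using assms(2)
    unfolding module.submodule_iff[OF assms(1)] module.submodule_iff[OF \<open>module R (M\<lparr>carrier := L\<rparr>)\<close>]
    by (simp add: subset_iff) blast
qed

lemma (in module) submodule_Inter:
  assumes "F \<noteq> {}" "\<And>H. H \<in> F \<Longrightarrow> submodule H R M"
  shows "submodule (\<Inter>F) R M"
  using assms unfolding submodule_iff by blast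

lemma (in module) submodule_Int:
  assumes "submodule H R M" "submodule K R M"
  shows "submodule (H \<inter> K) R M"
  using assms unfolding submodule_iff by blast

lemma (in module) submodule_zero: "submodule {\<zero>\<^bsub>M\<^esub>} R M"
  unfolding submodule_iff by simp

lemma (in module) submodule_Union_chain:
  assumes "C \<noteq> {}" "\<And>H. H \<in> C \<Longrightarrow> submodule H R M"
    and "\<And>H K. H \<in> C \<Longrightarrow> K \<in> C \<Longrightarrow> H \<subseteq> K \<or> K \<subseteq> H"
  shows "submodule (\<Union>C) R M"
  unfolding submodule_iff
proof (intro conjI ballI)
  note sub = assms(2)[unfolded submodule_iff]
  show "\<Union>C \<subseteq> carrier M" "\<zero>\<^bsub>M\<^esub> \<in> \<Union>C" using sub assms(1) by blast+
  fix a b assume "a \<in> \<Union>C" "b \<in> \<Union>C"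
  then obtain H where "H \<in> C" "a \<in> H" "b \<in> H" using assms(3) by blast
  then show "a \<oplus>\<^bsub>M\<^esub> b \<in> \<Union>C" using sub by blast
next
  fix r a assume "r \<in> carrier R" "a \<in> \<Union>C"
  then show "r \<odot>\<^bsub>M\<^esub> a \<in> \<Union>C" using assms(2)[unfolded submodule_iff] by blast
qed

lemma submodule_span_submodule:
  assumes "module R M" "S \<subseteq> carrier M"
  shows "submodule (submodule_span R M S) R M"
proof -
  have "carrier M \<in> {H. submodule H R M \<and> S \<subseteq> H}"
    using assms(2) module.carrier_is_submodule[OF assms(1)] by simp
  then show ?thesis
    unfolding submodule_span_def by (intro module.submodule_Inter[OF assms(1)]) blast+
qed

lemma submodule_span_superset: "S \<subseteq> submodule_span R M S"
  unfolding submodule_span_def by blast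

lemma submodule_span_least: "submodule H R M \<Longrightarrow> S \<subseteq> H \<Longrightarrow> submodule_span R M S \<subseteq> H"
  unfolding submodule_span_def by blast

lemma submodule_span_restrict:
  assumes "module R M" "submodule L R M" "S \<subseteq> L"
  shows "submodule_span R (M\<lparr>carrier := L\<rparr>) S = submodule_span R M S"
proof -
  have "\<Inter>{H. submodule H R M \<and> H \<subseteq> L \<and> S \<subseteq> H} = \<Inter>{H. submodule H R M \<and> S \<subseteq> H}"
    using module.submodule_Int[OF assms(1,2)] assms(2,3) by (intro equalityI subsetI) (blast+)
  then show ?thesis
    unfolding submodule_span_def submodule_restrict_iff[OF assms(1,2)] by (simp add: conj_ac)
qed

lemma artinian_restrict:
  assumes "B \<in> artinian_modules R" "submodule A R B"
  shows "B\<lparr>carrier := A\<rparr> \<in> artinian_modules R"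
proof -
  have B: "module R B" using assms(1) by (simp add: artinian_modules_def)
  show ?thesis
    using assms submodule.submodule_is_module[OF assms(2) B]
    unfolding artinian_modules_def mem_Collect_eq submodule_restrict_iff[OF B assms(2)] by blast
qed

lemma artinian_minimal:
  assumes B: "B \<in> artinian_modules R" and ne: "F \<noteq> {}" and F: "\<And>Z. Z \<in> F \<Longrightarrow> submodule Z R B"
  shows "\<exists>Z\<in>F. \<forall>Y\<in>F. Y \<subseteq> Z \<longrightarrow> Y = Z"
proof (rule ccontr)
  assume "\<not> ?thesis"
  then have "\<forall>Z\<in>F. \<exists>Y\<in>F. Y \<subset> Z" by blast
  then obtain g where g: "\<And>Z. Z \<in> F \<Longrightarrow> g Z \<in> F \<and> g Z \<subset> Z" by metis
  obtain Z0 where Z0: "Z0 \<in> F" using ne by blast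
  define H where "H n = (g ^^ n) Z0" for n :: nat
  have HF: "H n \<in> F" for n
  proof (induction n)
    case 0
    show ?case using Z0 by (simp add: H_def)
  next
    case (Suc n)
    then show ?case using g[of "H n"] by (simp add: H_def)
  qed
  have HS: "H (Suc n) \<subset> H n" for n
    using g[OF HF[of n]] by (simp add: H_def)
  have "\<forall>n. submodule (H n) R B \<and> H (Suc n) \<subseteq> H n" using F HF HS by blast
  then obtain n where n: "\<forall>k\<ge>n. H k = H n"
    using B unfolding artinian_modules_def by blast
  have "H (Suc n) = H n" by (rule n[rule_format]) simp
  with HS[of n] show False by blast
qed

lemma (in noetherian_ring) ideal_maximal:
  assumes ne: "F \<noteq> {}" and F: "\<And>I. I \<in> F \<Longrightarrow> ideal I R"
  shows "\<exists>I\<in>F. \<forall>J\<in>F. I \<subseteq> J \<longrightarrow> J = I"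
proof (rule subset_Zorn_nonempty[OF ne])
  fix C assume C: "C \<noteq> {}" "subset.chain F C"
  then have "subset.chain {I. ideal I R} C"
    using F by (auto simp: subset.chain_def)
  from ideal_chain_is_trivial[OF C(1) this] C(2) show "\<Union>C \<in> F"
    by (auto simp: subset.chain_def)
qed

section \<open>Matlis duals\<close>

lemma mod_homD:
  assumes "f \<in> mod_hom R M N"
  shows "x \<in> carrier M \<Longrightarrow> f x \<in> carrier N"
    and "x \<in> carrier M \<Longrightarrow> y \<in> carrier M \<Longrightarrow> f (x \<oplus>\<^bsub>M\<^esub> y) = f x \<oplus>\<^bsub>N\<^esub> f y"
    and "r \<in> carrier R \<Longrightarrow> x \<in> carrier M \<Longrightarrow> f (r \<odot>\<^bsub>M\<^esub> x) = r \<odot>\<^bsub>N\<^esub> f x"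
    and "x \<notin> carrier M \<Longrightarrow> f x = undefined"
  using assms unfolding mod_hom_def PiE_iff extensional_def by blast+

lemma mod_homI:
  assumes "\<And>x. x \<in> carrier M \<Longrightarrow> f x \<in> carrier N"
    and "\<And>x y. x \<in> carrier M \<Longrightarrow> y \<in> carrier M \<Longrightarrow> f (x \<oplus>\<^bsub>M\<^esub> y) = f x \<oplus>\<^bsub>N\<^esub> f y"
    and "\<And>r x. r \<in> carrier R \<Longrightarrow> x \<in> carrier M \<Longrightarrow> f (r \<odot>\<^bsub>M\<^esub> x) = r \<odot>\<^bsub>N\<^esub> f x"
    and "\<And>x. x \<notin> carrier M \<Longrightarrow> f x = undefined"
  shows "f \<in> mod_hom R M N"
  using assms unfolding mod_hom_def PiE_iff extensional_def by blast

lemma mod_hom_eqI: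
  assumes "f \<in> mod_hom R M N" "g \<in> mod_hom R M N" "\<And>x. x \<in> carrier M \<Longrightarrow> f x = g x"
  shows "f = g"
proof
  fix x
  show "f x = g x"
    using assms(3) mod_homD(4)[OF assms(1)] mod_homD(4)[OF assms(2)] by (cases "x \<in> carrier M") auto
qed

lemma mod_hom_zero:
  assumes "module R M" "module R N" "f \<in> mod_hom R M N"
  shows "f \<zero>\<^bsub>M\<^esub> = \<zero>\<^bsub>N\<^esub>"
proof -
  interpret M: module R M by fact
  interpret N: module R N by fact
  show ?thesis
    using mod_homD(3)[OF assms(3), of "\<zero>\<^bsub>R\<^esub>" "\<zero>\<^bsub>M\<^esub>"] mod_homD(1)[OF assms(3), of "\<zero>\<^bsub>M\<^esub>"] by simp
qed

lemma mod_hom_minus: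
  assumes "module R M" "module R N" "f \<in> mod_hom R M N" "x \<in> carrier M" "y \<in> carrier M"
  shows "f (x \<ominus>\<^bsub>M\<^esub> y) = f x \<ominus>\<^bsub>N\<^esub> f y"
proof -
  interpret M: module R M by fact
  interpret N: module R N by fact
  have "f (\<ominus>\<^bsub>M\<^esub> y) = \<ominus>\<^bsub>N\<^esub> f y"
    using mod_homD(3)[OF assms(3), of "\<ominus>\<^bsub>R\<^esub> \<one>\<^bsub>R\<^esub>" y] assms mod_homD(1)[OF assms(3,5)]
    by (simp add: M.smult_l_minus N.smult_l_minus)
  then show ?thesis
    using assms mod_homD(2)[OF assms(3), of x "\<ominus>\<^bsub>M\<^esub> y"] by (simp add: a_minus_def)
qed

lemma mod_hom_ker_submodule:
  assumes "module R M" "module R N" "f \<in> mod_hom R M N"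
  shows "submodule {x \<in> carrier M. f x = \<zero>\<^bsub>N\<^esub>} R M"
proof -
  interpret M: module R M by fact
  interpret N: module R N by fact
  show ?thesis
    unfolding M.submodule_iff using mod_homD[OF assms(3)] mod_hom_zero[OF assms] by auto
qed

lemma mod_hom_restrict:
  assumes "f \<in> mod_hom R M N" "module R M" "submodule L R M"
  shows "restrict f L \<in> mod_hom R (M\<lparr>carrier := L\<rparr>) N"
  using mod_homD[OF assms(1)] assms(3)[unfolded module.submodule_iff[OF assms(2)]]
  by (intro mod_homI) (auto simp: subset_iff)

lemma matlis_dual_simps [simp]:
  "carrier (matlis_dual R E M) = mod_hom R M E"
  "\<zero>\<^bsub>matlis_dual R E M\<^esub> = (\<lambda>x\<in>carrier M. \<zero>\<^bsub>E\<^esub>)"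
  "f \<oplus>\<^bsub>matlis_dual R E M\<^esub> g = (\<lambda>x\<in>carrier M. f x \<oplus>\<^bsub>E\<^esub> g x)"
  "r \<odot>\<^bsub>matlis_dual R E M\<^esub> f = (\<lambda>x\<in>carrier M. r \<odot>\<^bsub>E\<^esub> f x)"
  by (simp_all add: matlis_dual_def)

lemma module_matlis_dual:
  assumes "module R M" "module R E"
  shows "module R (matlis_dual R E M)"
proof -
  interpret M: module R M by fact
  interpret E: module R E by fact
  have [simp]: "f x \<in> carrier E" if "f \<in> mod_hom R M E" "x \<in> carrier M" for f x
    using that by (rule mod_homD(1))
  have add: "(\<lambda>x\<in>carrier M. f x \<oplus>\<^bsub>E\<^esub> g x) \<in> mod_hom R M E"
    if "f \<in> mod_hom R M E" "g \<in> mod_hom R M E" for f g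
    using that mod_homD(2,3)[OF that(1)] mod_homD(2,3)[OF that(2)]
    by (intro mod_homI) (auto simp: E.M.a_ac E.smult_r_distr)
  have sm: "(\<lambda>x\<in>carrier M. r \<odot>\<^bsub>E\<^esub> f x) \<in> mod_hom R M E"
    if "f \<in> mod_hom R M E" "r \<in> carrier R" for f r
    using that mod_homD(2,3)[OF that(1)]
    by (intro mod_homI) (auto simp: E.smult_r_distr E.smult_assoc1[symmetric] M.R.m_comm)
  have zero: "(\<lambda>x\<in>carrier M. \<zero>\<^bsub>E\<^esub>) \<in> mod_hom R M E"
    by (intro mod_homI) auto
  have "abelian_group (matlis_dual R E M)"
  proof (rule abelian_groupI, goal_cases)
    case (1 f g)
    then show ?case using add by simp
  next
    case 2
    then show ?case using zero by simp
  next
    case (3 f g h)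
    then show ?case by (simp add: E.M.a_assoc cong: restrict_cong)
  next
    case (4 f g)
    then show ?case by (simp add: E.M.a_comm cong: restrict_cong)
  next
    case (5 f)
    then show ?case using mod_homD(4)[of f R M E] by (auto simp: fun_eq_iff)
  next
    case (6 f)
    show ?case
    proof
      show "(\<lambda>x\<in>carrier M. (\<ominus>\<^bsub>R\<^esub> \<one>\<^bsub>R\<^esub>) \<odot>\<^bsub>E\<^esub> f x) \<in> carrier (matlis_dual R E M)"
        using 6 sm by simp
      show "(\<lambda>x\<in>carrier M. (\<ominus>\<^bsub>R\<^esub> \<one>\<^bsub>R\<^esub>) \<odot>\<^bsub>E\<^esub> f x) \<oplus>\<^bsub>matlis_dual R E M\<^esub> f = \<zero>\<^bsub>matlis_dual R E M\<^esub>"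
        using 6 by (auto simp: restrict_def E.smult_l_minus E.M.l_neg)
    qed
  qed
  then show ?thesis
  proof (rule moduleI[OF M.R.is_cring], goal_cases)
    case (1 r f)
    then show ?case using sm by simp
  next
    case (2 r s f)
    then show ?case by (simp add: E.smult_l_distr cong: restrict_cong)
  next
    case (3 r f g)
    then show ?case by (simp add: E.smult_r_distr cong: restrict_cong)
  next
    case (4 r s f)
    then show ?case by (simp add: E.smult_assoc1 cong: restrict_cong)
  next
    case (5 f)
    then show ?case using mod_homD(4)[of f R M E] by (auto simp: fun_eq_iff)
  qed
qed

lemma mem_dual_of_quotient:
  "f \<in> dual_of_quotient R E M L \<longleftrightarrow> f \<in> mod_hom R M E \<and> (\<forall>x\<in>L. f x = \<zero>\<^bsub>E\<^esub>)"
  by (simp add: dual_of_quotient_def)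

lemma mem_dual_of_dual_quotient:
  assumes "module R B" "module R E" "L \<subseteq> mod_hom R B E"
  shows "b \<in> dual_of_dual_quotient R E B L \<longleftrightarrow> b \<in> carrier B \<and> (\<forall>f\<in>L. f b = \<zero>\<^bsub>E\<^esub>)"
proof -
  have "biduality_map R E B b \<in> mod_hom R (matlis_dual R E B) E" if "b \<in> carrier B"
  proof -
    interpret D: module R "matlis_dual R E B" using module_matlis_dual assms by blast
    have "b \<in> carrier B" by fact
    then show ?thesis
      using D.smult_closed D.M.a_closed mod_homD(1)[of _ R B E]
      by (intro mod_homI) (simp_all add: biduality_map_def)
  qed
  then show ?thesis
    using assms(3) by (auto simp: dual_of_dual_quotient_def mem_dual_of_quotient biduality_map_def)
qed

section \<open>Local rings\<close>

lemma (in cring) ideal_iff: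
  "ideal I R \<longleftrightarrow> I \<subseteq> carrier R \<and> \<zero> \<in> I \<and> (\<forall>a\<in>I. \<forall>b\<in>I. a \<oplus> b \<in> I) \<and>
     (\<forall>r\<in>carrier R. \<forall>a\<in>I. r \<otimes> a \<in> I)" (is "_ \<longleftrightarrow> ?rhs")
proof
  assume "ideal I R"
  then interpret ideal I R .
  show ?rhs using I_l_closed Icarr a_closed zero_closed by blast
next
  assume rhs: ?rhs
  show "ideal I R"
  proof (rule idealI)
    show "subgroup I (add_monoid R)"
    proof (rule add.subgroupI)
      fix a assume a: "a \<in> I"
      have "\<ominus> a = (\<ominus> \<one>) \<otimes> a" using a rhs by (auto simp: l_minus)
      then show "\<ominus> a \<in> I" using a rhs by auto
    qed (use rhs in auto)
    fix a x assume "a \<in> I" "x \<in> carrier R"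
    then show "x \<otimes> a \<in> I" "a \<otimes> x \<in> I" using rhs m_comm[of a x] by auto
  qed (rule ring_axioms)
qed

lemma (in cring) ideal_adjoin:
  assumes I: "ideal I R" and x: "x \<in> carrier R"
  defines "J \<equiv> {a \<oplus> r \<otimes> x | a r. a \<in> I \<and> r \<in> carrier R}"
  shows "ideal J R" "I \<subseteq> J" "x \<in> J"
proof -
  interpret ideal I R by fact
  have mem: "a \<oplus> r \<otimes> x \<in> J" if "a \<in> I" "r \<in> carrier R" for a r
    using that unfolding J_def by blast
  show sub: "I \<subseteq> J"
  proof
    fix a assume a: "a \<in> I"
    then show "a \<in> J" using mem[of a \<zero>] x Icarr by simp
  qed
  show "x \<in> J" using mem[of \<zero> \<one>] x by simp
  show "ideal J R"
    unfolding ideal_iff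
  proof (intro conjI ballI)
    show "J \<subseteq> carrier R" using x Icarr by (auto simp: J_def)
    show "\<zero> \<in> J" using sub by auto
  next
    fix u v assume "u \<in> J" "v \<in> J"
    then obtain a r b s where *: "a \<in> I" "r \<in> carrier R" "u = a \<oplus> r \<otimes> x"
      "b \<in> I" "s \<in> carrier R" "v = b \<oplus> s \<otimes> x" unfolding J_def by blast
    then have "u \<oplus> v = (a \<oplus> b) \<oplus> (r \<oplus> s) \<otimes> x"
      using x Icarr by (simp add: l_distr a_ac)
    then show "u \<oplus> v \<in> J" using * mem by simp
  next
    fix s u assume s: "s \<in> carrier R" and "u \<in> J"
    then obtain a r where *: "a \<in> I" "r \<in> carrier R" "u = a \<oplus> r \<otimes> x" unfolding J_def by blast
    then have "s \<otimes> u = s \<otimes> a \<oplus> (s \<otimes> r) \<otimes> x"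
      using x Icarr s by (simp add: r_distr m_assoc)
    then show "s \<otimes> u \<in> J" using * mem s I_l_closed by simp
  qed
qed

locale complete_local =
  fixes R :: "('a, 'r) ring_scheme" (structure) and \<mm> :: "'a set"
  assumes complete: "complete_noetherian_local_ring R \<mm>"
begin

sublocale cring R
  using complete by (simp add: complete_noetherian_local_ring_def local_ring_def)

sublocale noetherian_ring R
  using complete by (simp add: complete_noetherian_local_ring_def)

sublocale \<mm>: maximalideal \<mm> R
  using complete by (simp add: complete_noetherian_local_ring_def local_ring_def)

lemma proper_ideal_subset:
  assumes I: "ideal I R" and "\<one> \<notin> I"
  shows "I \<subseteq> \<mm>"
proof -
  define F where "F = {J. ideal J R \<and> I \<subseteq> J \<and> \<one> \<notin> J}"
  have "\<exists>J\<in>F. \<forall>K\<in>F. J \<subseteq> K \<longrightarrow> K = J"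
    by (rule ideal_maximal) (use assms in \<open>auto simp: F_def\<close>)
  then obtain J where J: "J \<in> F" and max: "\<And>K. K \<in> F \<Longrightarrow> J \<subseteq> K \<Longrightarrow> K = J" by blast
  have "maximalideal J R"
  proof (rule maximalidealI)
    show "ideal J R" "carrier R \<noteq> J" using J by (auto simp: F_def)
    fix K assume K: "ideal K R" "J \<subseteq> K" "K \<subseteq> carrier R"
    show "K = J \<or> K = carrier R"
    proof (cases "\<one> \<in> K")
      case True
      then show ?thesis using ideal.one_imp_carrier[OF K(1)] by simp
    next
      case False
      then show ?thesis using max[of K] K J by (auto simp: F_def)
    qed
  qed
  then have "J = \<mm>"
    using complete by (simp add: complete_noetherian_local_ring_def local_ring_def)
  then show ?thesis using J by (simp add: F_def)
qed

lemma one_notin_max: "\<one> \<notin> \<mm>"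
  using \<mm>.one_imp_carrier \<mm>.I_notcarr by blast

lemma inverse_of_non_max:
  assumes r: "r \<in> carrier R" "r \<notin> \<mm>"
  obtains s where "s \<in> carrier R" "s \<otimes> r = \<one>"
proof -
  have "\<one> \<in> PIdl r"
    using proper_ideal_subset[OF cgenideal_ideal[OF r(1)]] cgenideal_self[OF r(1)] r(2) by blast
  then show ?thesis using that by (auto simp: cgenideal_def)
qed

text \<open>\<open>1 - t\<close> is a unit for \<open>t \<in> \<mm>\<close>.\<close>

lemma mem_ideal_of_max_multiple:
  assumes J: "ideal J R" and z: "z \<in> carrier R" and j: "j \<in> J" and t: "t \<in> \<mm>"
    and eq: "z = j \<oplus> t \<otimes> z"
  shows "z \<in> J"
proof -
  have [simp]: "t \<in> carrier R" "j \<in> carrier R" using t j \<mm>.Icarr ideal.Icarr[OF J] by auto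
  have "\<one> \<ominus> t \<notin> \<mm>"
  proof
    assume "\<one> \<ominus> t \<in> \<mm>"
    then have "(\<one> \<ominus> t) \<oplus> t \<in> \<mm>" using t by (rule \<mm>.a_closed)
    then show False using one_notin_max by (simp add: a_minus_def a_assoc l_neg)
  qed
  then obtain s where s: "s \<in> carrier R" "s \<otimes> (\<one> \<ominus> t) = \<one>"
    using inverse_of_non_max[of "\<one> \<ominus> t"] by auto
  have "(\<one> \<ominus> t) \<otimes> z = z \<ominus> t \<otimes> z"
    using z by (simp add: a_minus_def l_distr l_minus)
  also have "\<dots> = (j \<oplus> t \<otimes> z) \<ominus> t \<otimes> z" using eq by simp
  also have "\<dots> = j" using z by (simp add: a_minus_def a_assoc r_neg)
  finally have "z = s \<otimes> j" using s z m_assoc[of s "\<one> \<ominus> t" z] by simp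
  then show ?thesis using ideal.I_l_closed[OF J j] s(1) by simp
qed

lemma max_power_0: "ideal_power R \<mm> 0 = carrier R"
  by (simp add: ideal_power_def ideals_set_def)

lemma max_power_Suc: "ideal_power R \<mm> (Suc n) = ideal_prod R (ideal_power R \<mm> n) \<mm>"
  by (simp add: ideal_power_def ideals_set_def)

lemma ideal_max_power: "ideal (ideal_power R \<mm> n) R"
  by (induction n)
    (simp_all add: max_power_0 max_power_Suc oneideal ideal_prod_is_ideal \<mm>.is_ideal)

lemma max_power_smult: "x \<in> ideal_power R \<mm> n \<Longrightarrow> t \<in> \<mm> \<Longrightarrow> t \<otimes> x \<in> ideal_power R \<mm> (Suc n)"
  unfolding max_power_Suc
  using ideal_prod.prod[of x "ideal_power R \<mm> n" t \<mm> R] m_comm[of t x]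
    ideal.Icarr[OF ideal_max_power] \<mm>.Icarr by simp

lemma max_power_antimono: "i \<le> j \<Longrightarrow> ideal_power R \<mm> j \<subseteq> ideal_power R \<mm> i"
proof (induction j rule: dec_induct)
  case (step j)
  then show ?case
    using ideal_prod_inter[OF ideal_max_power[of j] \<mm>.is_ideal] by (auto simp: max_power_Suc)
qed simp

text \<open>
  The ascending chain condition replaces finite generation of \<open>K\<close> in Nakayama's lemma: an ideal
  \<open>J \<supseteq> I\<close> maximal with \<open>K \<not>\<subseteq> J\<close> contains \<open>\<mm>K\<close>.
\<close>

lemma nakayama_ideal:
  assumes I: "ideal I R" and n: "\<And>y. y \<in> ideal_power R \<mm> n \<Longrightarrow>
    \<exists>a\<in>I. \<exists>y'\<in>ideal_power R \<mm> (Suc n). y = a \<oplus> y'"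
  shows "ideal_power R \<mm> n \<subseteq> I"
proof (rule ccontr)
  let ?K = "ideal_power R \<mm> n"
  assume "\<not> ?thesis"
  define F where "F = {J. ideal J R \<and> I \<subseteq> J \<and> \<not> ?K \<subseteq> J}"
  have "\<exists>J\<in>F. \<forall>L\<in>F. J \<subseteq> L \<longrightarrow> L = J"
    by (rule ideal_maximal) (use I \<open>\<not> ?K \<subseteq> I\<close> in \<open>auto simp: F_def\<close>)
  then obtain J where JF: "J \<in> F" and max: "\<And>L. L \<in> F \<Longrightarrow> J \<subseteq> L \<Longrightarrow> L = J" by blast
  have J: "ideal J R" "I \<subseteq> J" using JF by (auto simp: F_def)
  interpret J: ideal J R by fact
  have mK: "t \<otimes> z \<in> J" if z: "z \<in> ?K" and t: "t \<in> \<mm>" for t z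
  proof (rule ccontr)
    assume nJ: "t \<otimes> z \<notin> J"
    have c: "z \<in> carrier R" "t \<in> carrier R"
      using z t ideal.Icarr[OF ideal_max_power] \<mm>.Icarr by auto
    define L where "L = {a \<oplus> r \<otimes> (t \<otimes> z) | a r. a \<in> J \<and> r \<in> carrier R}"
    have L: "ideal L R" "J \<subseteq> L" "t \<otimes> z \<in> L"
      using ideal_adjoin[OF J(1), of "t \<otimes> z"] c unfolding L_def by auto
    then have "?K \<subseteq> L" using max[of L] nJ J(2) by (auto simp: F_def)
    then obtain a r where ar: "a \<in> J" "r \<in> carrier R" "z = a \<oplus> r \<otimes> (t \<otimes> z)"
      using z unfolding L_def by blast
    then have "z = a \<oplus> (r \<otimes> t) \<otimes> z" using c by (simp add: m_assoc)
    from mem_ideal_of_max_multiple[OF J(1) c(1) ar(1) _ this] have "z \<in> J"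
      using \<mm>.I_l_closed t ar(2) by blast
    then show False using nJ c J.I_l_closed by blast
  qed
  have "y \<in> J" if "y \<in> ideal_prod R ?K \<mm>" for y
    using that
  proof induction
    case (prod z t)
    then show ?case
      using mK[of z t] m_comm[of z t] ideal.Icarr[OF ideal_max_power] \<mm>.Icarr by auto
  qed auto
  then have "?K \<subseteq> J" using n J(2) unfolding max_power_Suc by blast
  then show False using JF by (simp add: F_def)
qed

end

section \<open>The injective hull of the residue field\<close>

locale matlis = complete_local R \<mm>
  for R :: "('a, 'r) ring_scheme" (structure) and \<mm> :: "'a set" +
  fixes E :: "('a, 'e) module"
  assumes hull: "injective_hull R (residue_module R \<mm>) E"
begin

lemma injective: "injective_module TYPE('n) R E"
  using hull by - (rule injective_module_any_type, simp add: injective_hull_def)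

sublocale E: module R E
  using injective[where 'n = 'a] by (simp add: injective_module_def)

lemma socle_generator:
  obtains e where "e \<in> carrier E" "e \<noteq> \<zero>\<^bsub>E\<^esub>" "\<And>t. t \<in> \<mm> \<Longrightarrow> t \<odot>\<^bsub>E\<^esub> e = \<zero>\<^bsub>E\<^esub>"
    "\<And>x. x \<in> carrier E \<Longrightarrow> (\<And>t. t \<in> \<mm> \<Longrightarrow> t \<odot>\<^bsub>E\<^esub> x = \<zero>\<^bsub>E\<^esub>) \<Longrightarrow> \<exists>r\<in>carrier R. x = r \<odot>\<^bsub>E\<^esub> e"
proof -
  let ?k = "residue_module R \<mm>"
  obtain j where j: "j \<in> mod_hom R ?k E" "inj_on j (carrier ?k)"
    and ess: "\<And>H. submodule H R E \<Longrightarrow> H \<noteq> {\<zero>\<^bsub>E\<^esub>} \<Longrightarrow> H \<inter> j ` carrier ?k \<noteq> {\<zero>\<^bsub>E\<^esub>}"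
    using hull unfolding injective_hull_def by blast
  have k: "carrier ?k = {\<mm> +> r | r. r \<in> carrier R}"
    by (auto simp: residue_module_def FactRing_def A_RCOSETS_def')
  have ks: "r \<odot>\<^bsub>?k\<^esub> (\<mm> +> s) = \<mm> +> (r \<otimes> s)" if "r \<in> carrier R" "s \<in> carrier R" for r s
    using that by (simp add: residue_module_def FactRing_def \<mm>.rcoset_mult_add)
  define e where "e = j (\<mm> +> \<one>)"
  have e: "e \<in> carrier E" using mod_homD(1)[OF j(1)] k unfolding e_def by blast
  have je: "j (\<mm> +> r) = r \<odot>\<^bsub>E\<^esub> e" if "r \<in> carrier R" for r
    using mod_homD(3)[OF j(1) that, of "\<mm> +> \<one>"] ks[OF that one_closed] k that
    unfolding e_def by auto
  have zero: "\<mm> +> t = \<mm> +> \<zero>" if "t \<in> \<mm>" for t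
    using \<mm>.a_rcos_const that by simp
  have me: "t \<odot>\<^bsub>E\<^esub> e = \<zero>\<^bsub>E\<^esub>" if "t \<in> \<mm>" for t
    using je[of t] je[of \<zero>] zero[OF that] \<mm>.Icarr[OF that] e by simp
  have "e \<noteq> \<zero>\<^bsub>E\<^esub>"
  proof
    assume "e = \<zero>\<^bsub>E\<^esub>"
    then have "j (\<mm> +> \<one>) = j (\<mm> +> \<zero>)" using je[of \<one>] je[of \<zero>] by simp
    then have "\<mm> +> \<one> = \<mm> +> \<zero>" using j(2) k by (auto simp: inj_on_def)
    then have "\<one> \<in> \<mm>" using \<mm>.a_rcos_self[of \<one>] \<mm>.a_rcos_const[of \<zero>] by simp
    then show False using one_notin_max by simp
  qed
  moreover have "\<exists>r\<in>carrier R. x = r \<odot>\<^bsub>E\<^esub> e"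
    if x: "x \<in> carrier E" and mx: "\<And>t. t \<in> \<mm> \<Longrightarrow> t \<odot>\<^bsub>E\<^esub> x = \<zero>\<^bsub>E\<^esub>" for x
  proof (cases "x = \<zero>\<^bsub>E\<^esub>")
    case True
    then have "x = \<zero> \<odot>\<^bsub>E\<^esub> e" using e by simp
    then show ?thesis by blast
  next
    case False
    define H where "H = {r \<odot>\<^bsub>E\<^esub> x | r. r \<in> carrier R}"
    have mem: "r \<odot>\<^bsub>E\<^esub> x \<in> H" if "r \<in> carrier R" for r using that by (auto simp: H_def)
    have "submodule H R E"
      unfolding E.submodule_iff
    proof (intro conjI ballI)
      show "H \<subseteq> carrier E" using x by (auto simp: H_def)
      show "\<zero>\<^bsub>E\<^esub> \<in> H" using mem[of \<zero>] x by simp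
    next
      fix a b assume "a \<in> H" "b \<in> H"
      then obtain r s where "r \<in> carrier R" "s \<in> carrier R" "a = r \<odot>\<^bsub>E\<^esub> x" "b = s \<odot>\<^bsub>E\<^esub> x"
        by (auto simp: H_def)
      then show "a \<oplus>\<^bsub>E\<^esub> b \<in> H" using mem[of "r \<oplus> s"] x by (simp add: E.smult_l_distr)
    next
      fix r a assume "r \<in> carrier R" "a \<in> H"
      then obtain s where "s \<in> carrier R" "a = s \<odot>\<^bsub>E\<^esub> x" by (auto simp: H_def)
      then show "r \<odot>\<^bsub>E\<^esub> a \<in> H"
        using mem[of "r \<otimes> s"] x \<open>r \<in> carrier R\<close> by (simp add: E.smult_assoc1)
    qed
    moreover have "x \<in> H" using mem[of \<one>] x by simp
    ultimately have "H \<inter> j ` carrier ?k \<noteq> {\<zero>\<^bsub>E\<^esub>}" using ess[of H] False by blast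
    moreover have "\<zero>\<^bsub>E\<^esub> \<in> H \<inter> j ` carrier ?k"
    proof
      show "\<zero>\<^bsub>E\<^esub> \<in> H" using mem[of \<zero>] x by simp
      have "\<zero>\<^bsub>E\<^esub> = j (\<mm> +> \<zero>)" using je[of \<zero>] e by simp
      then show "\<zero>\<^bsub>E\<^esub> \<in> j ` carrier ?k" using k by blast
    qed
    ultimately obtain h where "h \<in> H" "h \<in> j ` carrier ?k" "h \<noteq> \<zero>\<^bsub>E\<^esub>" by blast
    then obtain r s where rs: "r \<in> carrier R" "s \<in> carrier R" "h = r \<odot>\<^bsub>E\<^esub> x" "h = s \<odot>\<^bsub>E\<^esub> e"
      using k je by (auto simp: H_def)
    then have "r \<notin> \<mm>" using mx \<open>h \<noteq> \<zero>\<^bsub>E\<^esub>\<close> by auto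
    then obtain u where u: "u \<in> carrier R" "u \<otimes> r = \<one>"
      using inverse_of_non_max[OF rs(1)] by blast
    have "x = (u \<otimes> r) \<odot>\<^bsub>E\<^esub> x" using u x by simp
    also have "\<dots> = u \<odot>\<^bsub>E\<^esub> h" using E.smult_assoc1[OF u(1) rs(1) x] rs(3) by simp
    also have "\<dots> = (u \<otimes> s) \<odot>\<^bsub>E\<^esub> e" using E.smult_assoc1[OF u(1) rs(2) e] rs(4) by simp
    finally show ?thesis using u rs by blast
  qed
  ultimately show ?thesis using that e me by blast
qed

lemma hom_graph_extends:
  fixes N :: "('a, 'n) module"
  assumes N: "module R N" and G: "hom_graph R N E G" and z: "(\<zero>\<^bsub>N\<^esub>, \<zero>\<^bsub>E\<^esub>) \<in> G"
  obtains g where "g \<in> mod_hom R N E" "\<And>x y. (x, y) \<in> G \<Longrightarrow> g x = y"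
proof -
  interpret N: module R N by fact
  let ?L = "fst ` G"
  have L: "submodule ?L R N"
    unfolding N.submodule_iff
  proof (intro conjI ballI)
    show "?L \<subseteq> carrier N" using G by (auto simp: hom_graph_def)
    show "\<zero>\<^bsub>N\<^esub> \<in> ?L" using z by force
  next
    fix a b assume "a \<in> ?L" "b \<in> ?L"
    then obtain a' b' where "(a, a') \<in> G" "(b, b') \<in> G" by auto
    then have "(a \<oplus>\<^bsub>N\<^esub> b, a' \<oplus>\<^bsub>E\<^esub> b') \<in> G" using G unfolding hom_graph_def by blast
    then show "a \<oplus>\<^bsub>N\<^esub> b \<in> ?L" by (rule image_eqI[rotated]) simp
  next
    fix r a assume "r \<in> carrier R" "a \<in> ?L"
    then obtain a' where "(a, a') \<in> G" by auto
    then have "(r \<odot>\<^bsub>N\<^esub> a, r \<odot>\<^bsub>E\<^esub> a') \<in> G"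
      using G \<open>r \<in> carrier R\<close> unfolding hom_graph_def by blast
    then show "r \<odot>\<^bsub>N\<^esub> a \<in> ?L" by (rule image_eqI[rotated]) simp
  qed
  have "G \<subseteq> ?L \<times> carrier E"
    using G unfolding hom_graph_def by (intro subsetI) (auto intro: rev_image_eqI)
  then have "hom_graph R (N\<lparr>carrier := ?L\<rparr>) E G"
    using G by (simp add: hom_graph_def)
  then obtain f where f: "f \<in> mod_hom R (N\<lparr>carrier := ?L\<rparr>) E" "\<forall>(x, y)\<in>G. f x = y"
    using hom_graph_total[of R "N\<lparr>carrier := ?L\<rparr>" E G]
      submodule.submodule_is_module[OF L N] by auto
  have "\<forall>f\<in>mod_hom R (N\<lparr>carrier := ?L\<rparr>) E. \<exists>g\<in>mod_hom R N E. \<forall>x\<in>?L. g x = f x"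
    using injective[where 'n = 'n] N L unfolding injective_module_def by (elim conjE allE impE) auto
  then obtain g where g: "g \<in> mod_hom R N E" "\<forall>x\<in>?L. g x = f x" using f(1) by blast
  have "g x = y" if "(x, y) \<in> G" for x y
    using g(2) f(2) that by fastforce
  with g(1) show ?thesis by (rule that)
qed

lemma separating_hom:
  assumes N: "module R N" and A: "submodule A R N" and b: "b \<in> carrier N" "b \<notin> A"
  obtains f where "f \<in> mod_hom R N E" "\<And>a. a \<in> A \<Longrightarrow> f a = \<zero>\<^bsub>E\<^esub>" "f b \<noteq> \<zero>\<^bsub>E\<^esub>"
proof -
  interpret N: module R N by fact
  obtain e where e: "e \<in> carrier E" "e \<noteq> \<zero>\<^bsub>E\<^esub>" "\<And>t. t \<in> \<mm> \<Longrightarrow> t \<odot>\<^bsub>E\<^esub> e = \<zero>\<^bsub>E\<^esub>"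
    using socle_generator by metis
  have Ac: "A \<subseteq> carrier N" and A0: "\<zero>\<^bsub>N\<^esub> \<in> A"
    and Aa: "\<And>x y. x \<in> A \<Longrightarrow> y \<in> A \<Longrightarrow> x \<oplus>\<^bsub>N\<^esub> y \<in> A"
    and As: "\<And>r x. r \<in> carrier R \<Longrightarrow> x \<in> A \<Longrightarrow> r \<odot>\<^bsub>N\<^esub> x \<in> A"
    using A unfolding N.submodule_iff by blast+
  define I where "I = {r \<in> carrier R. r \<odot>\<^bsub>N\<^esub> b \<in> A}"
  have "ideal I R"
    unfolding ideal_iff I_def using A0 Aa As b by (auto simp: N.smult_l_distr N.smult_assoc1)
  moreover have "\<one> \<notin> I" using b by (simp add: I_def)
  ultimately have I: "I \<subseteq> \<mm>" by (rule proper_ideal_subset)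
  define G where "G = {(a \<oplus>\<^bsub>N\<^esub> r \<odot>\<^bsub>N\<^esub> b, r \<odot>\<^bsub>E\<^esub> e) | a r. a \<in> A \<and> r \<in> carrier R}"
  have mem: "(a \<oplus>\<^bsub>N\<^esub> r \<odot>\<^bsub>N\<^esub> b, r \<odot>\<^bsub>E\<^esub> e) \<in> G" if "a \<in> A" "r \<in> carrier R" for a r
    using that unfolding G_def by blast
  have c: "a \<in> carrier N" if "a \<in> A" for a using that Ac by blast
  have "hom_graph R N E G"
    unfolding hom_graph_def
  proof (intro conjI allI impI ballI)
    show "G \<subseteq> carrier N \<times> carrier E" using c b e by (auto simp: G_def)
  next
    fix x y x' y' assume "(x, y) \<in> G" "(x', y') \<in> G"
    then obtain a r a' r' where *: "a \<in> A" "r \<in> carrier R" "a' \<in> A" "r' \<in> carrier R"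
      "x = a \<oplus>\<^bsub>N\<^esub> r \<odot>\<^bsub>N\<^esub> b" "y = r \<odot>\<^bsub>E\<^esub> e" "x' = a' \<oplus>\<^bsub>N\<^esub> r' \<odot>\<^bsub>N\<^esub> b" "y' = r' \<odot>\<^bsub>E\<^esub> e"
      unfolding G_def by blast
    then have "x \<oplus>\<^bsub>N\<^esub> x' = (a \<oplus>\<^bsub>N\<^esub> a') \<oplus>\<^bsub>N\<^esub> (r \<oplus> r') \<odot>\<^bsub>N\<^esub> b" "y \<oplus>\<^bsub>E\<^esub> y' = (r \<oplus> r') \<odot>\<^bsub>E\<^esub> e"
      using c b e by (simp_all add: N.smult_l_distr E.smult_l_distr N.M.a_ac)
    then show "(x \<oplus>\<^bsub>N\<^esub> x', y \<oplus>\<^bsub>E\<^esub> y') \<in> G" using mem[of "a \<oplus>\<^bsub>N\<^esub> a'" "r \<oplus> r'"] * Aa by simp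
  next
    fix s x y assume s: "s \<in> carrier R" and "(x, y) \<in> G"
    then obtain a r where *: "a \<in> A" "r \<in> carrier R" "x = a \<oplus>\<^bsub>N\<^esub> r \<odot>\<^bsub>N\<^esub> b" "y = r \<odot>\<^bsub>E\<^esub> e"
      unfolding G_def by blast
    then have "s \<odot>\<^bsub>N\<^esub> x = s \<odot>\<^bsub>N\<^esub> a \<oplus>\<^bsub>N\<^esub> (s \<otimes> r) \<odot>\<^bsub>N\<^esub> b" "s \<odot>\<^bsub>E\<^esub> y = (s \<otimes> r) \<odot>\<^bsub>E\<^esub> e"
      using c b e s by (simp_all add: N.smult_r_distr N.smult_assoc1 E.smult_assoc1)
    then show "(s \<odot>\<^bsub>N\<^esub> x, s \<odot>\<^bsub>E\<^esub> y) \<in> G" using mem[of "s \<odot>\<^bsub>N\<^esub> a" "s \<otimes> r"] * As s by simp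
  next
    fix x y y' assume "(x, y) \<in> G" "(x, y') \<in> G"
    then obtain a r a' r' where *: "a \<in> A" "r \<in> carrier R" "a' \<in> A" "r' \<in> carrier R"
      "x = a \<oplus>\<^bsub>N\<^esub> r \<odot>\<^bsub>N\<^esub> b" "y = r \<odot>\<^bsub>E\<^esub> e" "x = a' \<oplus>\<^bsub>N\<^esub> r' \<odot>\<^bsub>N\<^esub> b" "y' = r' \<odot>\<^bsub>E\<^esub> e"
      unfolding G_def by blast
    have "(r \<ominus> r') \<odot>\<^bsub>N\<^esub> b = (\<ominus>\<^bsub>N\<^esub> a \<oplus>\<^bsub>N\<^esub> (a \<oplus>\<^bsub>N\<^esub> r \<odot>\<^bsub>N\<^esub> b)) \<ominus>\<^bsub>N\<^esub> r' \<odot>\<^bsub>N\<^esub> b"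
      using * c b by (simp add: a_minus_def N.smult_l_distr N.smult_l_minus N.M.r_neg1)
    also have "\<dots> = (\<ominus>\<^bsub>N\<^esub> a \<oplus>\<^bsub>N\<^esub> (a' \<oplus>\<^bsub>N\<^esub> r' \<odot>\<^bsub>N\<^esub> b)) \<ominus>\<^bsub>N\<^esub> r' \<odot>\<^bsub>N\<^esub> b"
      using * by metis
    also have "\<dots> = \<ominus>\<^bsub>N\<^esub> a \<oplus>\<^bsub>N\<^esub> a'"
      using c[OF *(1)] c[OF *(3)] *(2,4) b by (simp add: a_minus_def N.M.a_assoc N.M.r_neg)
    finally have "(r \<ominus> r') \<odot>\<^bsub>N\<^esub> b \<in> A"
      using * Aa N.submoduleE(3)[OF A] by simp
    then have "r \<ominus> r' \<in> \<mm>" using I * by (auto simp: I_def)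
    then have "\<zero>\<^bsub>E\<^esub> = (r \<ominus> r') \<odot>\<^bsub>E\<^esub> e" using e(3) by simp
    then have "y \<ominus>\<^bsub>E\<^esub> y' = \<zero>\<^bsub>E\<^esub>"
      using *(2,4,6,8) e(1) by (simp add: a_minus_def E.smult_l_distr E.smult_l_minus)
    then show "y = y'" using E.M.eq_of_minus_eq_zero *(2,4,6,8) e(1) by simp
  qed
  moreover have "(\<zero>\<^bsub>N\<^esub>, \<zero>\<^bsub>E\<^esub>) \<in> G" using mem[of "\<zero>\<^bsub>N\<^esub>" \<zero>] A0 b e by simp
  ultimately obtain f where f: "f \<in> mod_hom R N E" "\<And>x y. (x, y) \<in> G \<Longrightarrow> f x = y"
    using hom_graph_extends[OF N] by blast
  show ?thesis
  proof (rule that[OF f(1)])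
    fix a assume a: "a \<in> A"
    then show "f a = \<zero>\<^bsub>E\<^esub>" using f(2)[OF mem[of a \<zero>]] b e c by simp
  next
    show "f b \<noteq> \<zero>\<^bsub>E\<^esub>" using f(2)[OF mem[of "\<zero>\<^bsub>N\<^esub>" \<one>]] A0 b e by simp
  qed
qed

end

section \<open>Endomorphisms of the injective hull\<close>

context matlis
begin

text \<open>
  Descending induction on \<open>I\<close>: if \<open>J = I + Rx\<close> with \<open>\<mm>x \<subseteq> I\<close> and \<open>\<phi> = r\<close> on \<open>(0 :\<^sub>E J)\<close>, then
  \<open>\<phi> - r\<close> on \<open>(0 :\<^sub>E I)\<close> factors through multiplication by \<open>x\<close> into the one-dimensional socle.
\<close>

lemma endomorphism_step:
  assumes \<phi>: "\<phi> \<in> mod_hom R E E" and I: "ideal I R"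
    and x: "x \<in> carrier R" and mx: "\<And>t. t \<in> \<mm> \<Longrightarrow> t \<otimes> x \<in> I"
    and r: "r \<in> carrier R"
    and hyp: "\<And>e. e \<in> carrier E \<Longrightarrow> (\<And>y. y \<in> I \<Longrightarrow> y \<odot>\<^bsub>E\<^esub> e = \<zero>\<^bsub>E\<^esub>) \<Longrightarrow> x \<odot>\<^bsub>E\<^esub> e = \<zero>\<^bsub>E\<^esub> \<Longrightarrow>
      \<phi> e = r \<odot>\<^bsub>E\<^esub> e"
  shows "\<exists>s\<in>carrier R. \<forall>e\<in>carrier E. (\<forall>y\<in>I. y \<odot>\<^bsub>E\<^esub> e = \<zero>\<^bsub>E\<^esub>) \<longrightarrow> \<phi> e = s \<odot>\<^bsub>E\<^esub> e"
proof (cases "\<forall>e\<in>carrier E. (\<forall>y\<in>I. y \<odot>\<^bsub>E\<^esub> e = \<zero>\<^bsub>E\<^esub>) \<longrightarrow> x \<odot>\<^bsub>E\<^esub> e = \<zero>\<^bsub>E\<^esub>")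
  case True
  then show ?thesis using hyp r by blast
next
  case False
  then obtain f where f: "f \<in> carrier E" "\<And>y. y \<in> I \<Longrightarrow> y \<odot>\<^bsub>E\<^esub> f = \<zero>\<^bsub>E\<^esub>" "x \<odot>\<^bsub>E\<^esub> f \<noteq> \<zero>\<^bsub>E\<^esub>"
    by blast
  obtain g where g: "g \<in> carrier E" "\<And>t. t \<in> \<mm> \<Longrightarrow> t \<odot>\<^bsub>E\<^esub> g = \<zero>\<^bsub>E\<^esub>"
    and soc: "\<And>e. e \<in> carrier E \<Longrightarrow> (\<And>t. t \<in> \<mm> \<Longrightarrow> t \<odot>\<^bsub>E\<^esub> e = \<zero>\<^bsub>E\<^esub>) \<Longrightarrow> \<exists>r\<in>carrier R. e = r \<odot>\<^bsub>E\<^esub> g"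
    using socle_generator by metis
  note Icarr = ideal.Icarr[OF I]
  have xsoc: "t \<odot>\<^bsub>E\<^esub> (x \<odot>\<^bsub>E\<^esub> e) = \<zero>\<^bsub>E\<^esub>"
    if "e \<in> carrier E" "\<And>y. y \<in> I \<Longrightarrow> y \<odot>\<^bsub>E\<^esub> e = \<zero>\<^bsub>E\<^esub>" "t \<in> \<mm>" for e t
    using that mx[OF that(3)] x \<mm>.Icarr E.smult_assoc1[of t x e] by simp
  obtain u where u: "u \<in> carrier R" "x \<odot>\<^bsub>E\<^esub> f = u \<odot>\<^bsub>E\<^esub> g"
    using soc[of "x \<odot>\<^bsub>E\<^esub> f"] xsoc f(1,2) x by blast
  have "u \<notin> \<mm>" using u f(3) g(2) by auto
  then obtain v where v: "v \<in> carrier R" "v \<otimes> u = \<one>" using inverse_of_non_max[OF u(1)] by blast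
  have gf: "g = v \<odot>\<^bsub>E\<^esub> (x \<odot>\<^bsub>E\<^esub> f)"
    using E.smult_assoc1[OF v(1) u(1) g(1)] v(2) u(2) g(1) by simp
  have soc': "\<exists>p\<in>carrier R. e = p \<odot>\<^bsub>E\<^esub> (x \<odot>\<^bsub>E\<^esub> f)"
    if e: "e \<in> carrier E" and me: "\<And>t. t \<in> \<mm> \<Longrightarrow> t \<odot>\<^bsub>E\<^esub> e = \<zero>\<^bsub>E\<^esub>" for e
  proof -
    obtain p where p: "p \<in> carrier R" "e = p \<odot>\<^bsub>E\<^esub> g" using soc[OF e me] by blast
    have "e = (p \<otimes> v) \<odot>\<^bsub>E\<^esub> (x \<odot>\<^bsub>E\<^esub> f)"
      using E.smult_assoc1[OF p(1) v(1), of "x \<odot>\<^bsub>E\<^esub> f"] p(2) gf x f(1) by simp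
    then show ?thesis using p(1) v(1) by blast
  qed
  define \<psi> where "\<psi> e = \<phi> e \<ominus>\<^bsub>E\<^esub> r \<odot>\<^bsub>E\<^esub> e" for e
  note \<phi>c = mod_homD(1)[OF \<phi>]
  have \<psi>c: "\<psi> e \<in> carrier E" if "e \<in> carrier E" for e using that \<phi>c r by (simp add: \<psi>_def)
  have \<psi>s: "\<psi> (s \<odot>\<^bsub>E\<^esub> e) = s \<odot>\<^bsub>E\<^esub> \<psi> e" if "s \<in> carrier R" "e \<in> carrier E" for s e
    using that \<phi>c r mod_homD(3)[OF \<phi>]
    by (simp add: \<psi>_def a_minus_def E.smult_r_distr E.smult_r_minus E.smult_left_commute)
  have \<psi>0: "\<psi> e = \<zero>\<^bsub>E\<^esub>"
    if "e \<in> carrier E" "\<And>y. y \<in> I \<Longrightarrow> y \<odot>\<^bsub>E\<^esub> e = \<zero>\<^bsub>E\<^esub>" "x \<odot>\<^bsub>E\<^esub> e = \<zero>\<^bsub>E\<^esub>" for e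
    using hyp[OF that] that(1) r by (simp add: \<psi>_def a_minus_def E.M.r_neg)
  have "t \<odot>\<^bsub>E\<^esub> \<psi> f = \<zero>\<^bsub>E\<^esub>" if t: "t \<in> \<mm>" for t
  proof -
    have tc: "t \<in> carrier R" using t by (rule \<mm>.Icarr)
    have "\<psi> (t \<odot>\<^bsub>E\<^esub> f) = \<zero>\<^bsub>E\<^esub>"
    proof (rule \<psi>0)
      show "t \<odot>\<^bsub>E\<^esub> f \<in> carrier E" using tc f by simp
      show "x \<odot>\<^bsub>E\<^esub> (t \<odot>\<^bsub>E\<^esub> f) = \<zero>\<^bsub>E\<^esub>"
        using xsoc[OF f(1,2) t] E.smult_left_commute[OF x tc f(1)] by simp
      fix y assume y: "y \<in> I"
      then show "y \<odot>\<^bsub>E\<^esub> (t \<odot>\<^bsub>E\<^esub> f) = \<zero>\<^bsub>E\<^esub>"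
        using E.smult_left_commute[OF Icarr[OF y] tc f(1)] f(2)[OF y] tc by simp
    qed
    then show ?thesis using \<psi>s[OF tc f(1)] by simp
  qed
  then obtain c where c: "c \<in> carrier R" "\<psi> f = c \<odot>\<^bsub>E\<^esub> (x \<odot>\<^bsub>E\<^esub> f)"
    using soc' \<psi>c[OF f(1)] by blast
  have "\<phi> e = (r \<oplus> c \<otimes> x) \<odot>\<^bsub>E\<^esub> e"
    if e: "e \<in> carrier E" and Ie: "\<And>y. y \<in> I \<Longrightarrow> y \<odot>\<^bsub>E\<^esub> e = \<zero>\<^bsub>E\<^esub>" for e
  proof -
    have xe: "x \<odot>\<^bsub>E\<^esub> e \<in> carrier E" using e x by simp
    obtain q where q: "q \<in> carrier R" "x \<odot>\<^bsub>E\<^esub> e = q \<odot>\<^bsub>E\<^esub> (x \<odot>\<^bsub>E\<^esub> f)"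
      using soc'[OF xe] xsoc[OF e Ie] by blast
    let ?d = "e \<ominus>\<^bsub>E\<^esub> q \<odot>\<^bsub>E\<^esub> f"
    have d: "?d \<in> carrier E" using e q(1) f(1) by simp
    have sd: "s \<odot>\<^bsub>E\<^esub> ?d = s \<odot>\<^bsub>E\<^esub> e \<ominus>\<^bsub>E\<^esub> q \<odot>\<^bsub>E\<^esub> (s \<odot>\<^bsub>E\<^esub> f)" if "s \<in> carrier R" for s
      using that e q(1) f(1) E.smult_left_commute[OF that q(1) f(1)]
      by (simp add: a_minus_def E.smult_r_distr E.smult_r_minus)
    have "\<psi> ?d = \<zero>\<^bsub>E\<^esub>"
    proof (rule \<psi>0[OF d])
      show "x \<odot>\<^bsub>E\<^esub> ?d = \<zero>\<^bsub>E\<^esub>"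
        using sd[OF x] q(2) q(1) x f(1) by (simp add: a_minus_def E.M.r_neg)
      fix y assume "y \<in> I"
      then show "y \<odot>\<^bsub>E\<^esub> ?d = \<zero>\<^bsub>E\<^esub>"
        using sd[OF Icarr] Ie f(2) q(1) by (simp add: a_minus_def E.M.r_neg)
    qed
    moreover have "e = ?d \<oplus>\<^bsub>E\<^esub> q \<odot>\<^bsub>E\<^esub> f"
      using e q(1) f(1) by (simp add: a_minus_def E.M.a_assoc E.M.l_neg)
    moreover have "\<psi> (a \<oplus>\<^bsub>E\<^esub> b) = \<psi> a \<oplus>\<^bsub>E\<^esub> \<psi> b" if "a \<in> carrier E" "b \<in> carrier E" for a b
      using that r \<phi>c mod_homD(2)[OF \<phi> that]
      by (simp add: \<psi>_def a_minus_def E.smult_r_distr E.M.minus_add E.M.a_ac)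
    ultimately have "\<psi> e = \<psi> (q \<odot>\<^bsub>E\<^esub> f)" using d q(1) f(1) \<psi>c by (metis E.M.l_zero E.smult_closed)
    also have "\<dots> = q \<odot>\<^bsub>E\<^esub> (c \<odot>\<^bsub>E\<^esub> (x \<odot>\<^bsub>E\<^esub> f))" using \<psi>s[OF q(1) f(1)] c(2) by simp
    also have "\<dots> = c \<odot>\<^bsub>E\<^esub> (q \<odot>\<^bsub>E\<^esub> (x \<odot>\<^bsub>E\<^esub> f))"
      using E.smult_left_commute[OF q(1) c(1)] x f(1) by simp
    also have "\<dots> = (c \<otimes> x) \<odot>\<^bsub>E\<^esub> e" using q(2) E.smult_assoc1[OF c(1) x e] by simp
    finally have \<psi>e: "\<psi> e = (c \<otimes> x) \<odot>\<^bsub>E\<^esub> e" .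
    have "\<phi> e = r \<odot>\<^bsub>E\<^esub> e \<oplus>\<^bsub>E\<^esub> \<psi> e"
      using \<phi>c[OF e] r e by (simp add: \<psi>_def a_minus_def E.M.a_ac E.M.r_neg)
    then show ?thesis using \<psi>e r c(1) x e by (simp add: E.smult_l_distr)
  qed
  then show ?thesis using r c(1) x by blast
qed

lemma endomorphism_on_annihilator:
  assumes \<phi>: "\<phi> \<in> mod_hom R E E" and I: "ideal I R" and n: "ideal_power R \<mm> n \<subseteq> I"
  shows "\<exists>r\<in>carrier R. \<forall>e\<in>carrier E. (\<forall>y\<in>I. y \<odot>\<^bsub>E\<^esub> e = \<zero>\<^bsub>E\<^esub>) \<longrightarrow> \<phi> e = r \<odot>\<^bsub>E\<^esub> e"
proof (rule ccontr)
  let ?P = "\<lambda>I. \<exists>r\<in>carrier R. \<forall>e\<in>carrier E. (\<forall>y\<in>I. y \<odot>\<^bsub>E\<^esub> e = \<zero>\<^bsub>E\<^esub>) \<longrightarrow> \<phi> e = r \<odot>\<^bsub>E\<^esub> e"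
  assume "\<not> ?P I"
  define F where "F = {J. ideal J R \<and> ideal_power R \<mm> n \<subseteq> J \<and> \<not> ?P J}"
  have "\<exists>J\<in>F. \<forall>L\<in>F. J \<subseteq> L \<longrightarrow> L = J"
    by (rule ideal_maximal) (use I n \<open>\<not> ?P I\<close> in \<open>auto simp: F_def\<close>)
  then obtain J where JF: "J \<in> F" and max: "\<And>L. L \<in> F \<Longrightarrow> J \<subseteq> L \<Longrightarrow> L = J" by blast
  have J: "ideal J R" "ideal_power R \<mm> n \<subseteq> J" "\<not> ?P J" using JF unfolding F_def by blast+
  have "\<one> \<notin> J"
  proof
    assume "\<one> \<in> J"
    have "\<phi> e = \<zero> \<odot>\<^bsub>E\<^esub> e" if "e \<in> carrier E" "\<forall>y\<in>J. y \<odot>\<^bsub>E\<^esub> e = \<zero>\<^bsub>E\<^esub>" for e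
    proof -
      have "e = \<zero>\<^bsub>E\<^esub>" using that \<open>\<one> \<in> J\<close> E.smult_one by metis
      then show ?thesis using mod_hom_zero[OF E.module_axioms E.module_axioms \<phi>] by simp
    qed
    then show False using J(3) zero_closed by blast
  qed
  define k where "k = (LEAST k. ideal_power R \<mm> k \<subseteq> J)"
  have k: "ideal_power R \<mm> k \<subseteq> J" unfolding k_def by (rule LeastI) (rule J(2))
  have "k \<noteq> 0" using k \<open>\<one> \<notin> J\<close> max_power_0 by (metis one_closed subsetD)
  then obtain l where l: "k = Suc l" using not0_implies_Suc by blast
  then have "l < k" by simp
  then have "\<not> ideal_power R \<mm> l \<subseteq> J" unfolding k_def by (rule not_less_Least)
  then obtain x where x: "x \<in> ideal_power R \<mm> l" "x \<notin> J" by blast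
  have xc: "x \<in> carrier R" using x(1) ideal.Icarr[OF ideal_max_power] by blast
  have mx: "t \<otimes> x \<in> J" if "t \<in> \<mm>" for t using max_power_smult[OF x(1) that] k l by blast
  define L where "L = {a \<oplus> r \<otimes> x | a r. a \<in> J \<and> r \<in> carrier R}"
  have L: "ideal L R" "J \<subseteq> L" "x \<in> L" using ideal_adjoin[OF J(1) xc] unfolding L_def by auto
  then have "L \<notin> F" using max x(2) by blast
  then have "?P L" using L J(2) unfolding F_def by blast
  then obtain r where r: "r \<in> carrier R"
    "\<And>e. e \<in> carrier E \<Longrightarrow> \<forall>y\<in>L. y \<odot>\<^bsub>E\<^esub> e = \<zero>\<^bsub>E\<^esub> \<Longrightarrow> \<phi> e = r \<odot>\<^bsub>E\<^esub> e" by blast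
  have "?P J"
  proof (rule endomorphism_step[OF \<phi> J(1) xc mx r(1)])
    fix e assume e: "e \<in> carrier E" "\<And>y. y \<in> J \<Longrightarrow> y \<odot>\<^bsub>E\<^esub> e = \<zero>\<^bsub>E\<^esub>" "x \<odot>\<^bsub>E\<^esub> e = \<zero>\<^bsub>E\<^esub>"
    have "\<forall>y\<in>L. y \<odot>\<^bsub>E\<^esub> e = \<zero>\<^bsub>E\<^esub>"
      using e xc ideal.Icarr[OF J(1)] by (auto simp: L_def E.smult_l_distr E.smult_assoc1)
    then show "\<phi> e = r \<odot>\<^bsub>E\<^esub> e" using r(2) e(1) by blast
  qed
  then show False using J(3) by blast
qed

lemma max_power_faithful:
  assumes x: "x \<in> carrier R" "x \<notin> ideal_power R \<mm> n"
  obtains e where "e \<in> carrier E" "\<And>y. y \<in> ideal_power R \<mm> n \<Longrightarrow> y \<odot>\<^bsub>E\<^esub> e = \<zero>\<^bsub>E\<^esub>"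
    "x \<odot>\<^bsub>E\<^esub> e \<noteq> \<zero>\<^bsub>E\<^esub>"
proof -
  interpret RR: module R "regular_module R" by (rule module_regular_module) (rule is_cring)
  have RRs: "carrier (regular_module R) = carrier R" "\<zero>\<^bsub>regular_module R\<^esub> = \<zero>"
    "\<And>a b. a \<oplus>\<^bsub>regular_module R\<^esub> b = a \<oplus> b" "\<And>a b. a \<odot>\<^bsub>regular_module R\<^esub> b = a \<otimes> b"
    by (simp_all add: regular_module_def)
  have "submodule (ideal_power R \<mm> n) R (regular_module R)"
    using ideal_max_power[of n] unfolding RR.submodule_iff RRs ideal_iff .
  then obtain f where f: "f \<in> mod_hom R (regular_module R) E"
    "\<And>a. a \<in> ideal_power R \<mm> n \<Longrightarrow> f a = \<zero>\<^bsub>E\<^esub>" "f x \<noteq> \<zero>\<^bsub>E\<^esub>"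
    using separating_hom[OF RR.module_axioms] x by (metis RRs(1))
  have fr: "f r = r \<odot>\<^bsub>E\<^esub> f \<one>" if "r \<in> carrier R" for r
    using mod_homD(3)[OF f(1), of r \<one>] that by (simp add: RRs)
  show ?thesis
  proof (rule that)
    show "f \<one> \<in> carrier E" using mod_homD(1)[OF f(1), of \<one>] by (simp add: RRs)
    show "x \<odot>\<^bsub>E\<^esub> f \<one> \<noteq> \<zero>\<^bsub>E\<^esub>" using f(3) fr[OF x(1)] by simp
    fix y assume "y \<in> ideal_power R \<mm> n"
    then show "y \<odot>\<^bsub>E\<^esub> f \<one> = \<zero>\<^bsub>E\<^esub>" using f(2) fr[of y] ideal.Icarr[OF ideal_max_power] by metis
  qed
qed

lemma endomorphism_scalar:
  assumes \<phi>: "\<phi> \<in> mod_hom R E E"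
  obtains r where "r \<in> carrier R"
    "\<And>e n. e \<in> carrier E \<Longrightarrow> (\<And>y. y \<in> ideal_power R \<mm> n \<Longrightarrow> y \<odot>\<^bsub>E\<^esub> e = \<zero>\<^bsub>E\<^esub>) \<Longrightarrow> \<phi> e = r \<odot>\<^bsub>E\<^esub> e"
proof -
  let ?K = "ideal_power R \<mm>"
  have "\<forall>n. \<exists>r\<in>carrier R. \<forall>e\<in>carrier E. (\<forall>y\<in>?K n. y \<odot>\<^bsub>E\<^esub> e = \<zero>\<^bsub>E\<^esub>) \<longrightarrow> \<phi> e = r \<odot>\<^bsub>E\<^esub> e"
    using endomorphism_on_annihilator[OF \<phi> ideal_max_power subset_refl] by blast
  then obtain s where s: "\<And>n. s n \<in> carrier R"
    "\<And>n e. e \<in> carrier E \<Longrightarrow> \<forall>y\<in>?K n. y \<odot>\<^bsub>E\<^esub> e = \<zero>\<^bsub>E\<^esub> \<Longrightarrow> \<phi> e = s n \<odot>\<^bsub>E\<^esub> e"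
    by metis
  have s': "\<phi> e = s i \<odot>\<^bsub>E\<^esub> e" if "e \<in> carrier E" "\<forall>y\<in>?K n. y \<odot>\<^bsub>E\<^esub> e = \<zero>\<^bsub>E\<^esub>" "n \<le> i" for e n i
    using s(2)[of e i] that max_power_antimono[OF that(3)] by blast
  have diff: "(s i \<ominus> r) \<odot>\<^bsub>E\<^esub> e = \<phi> e \<ominus>\<^bsub>E\<^esub> r \<odot>\<^bsub>E\<^esub> e"
    if "e \<in> carrier E" "\<forall>y\<in>?K n. y \<odot>\<^bsub>E\<^esub> e = \<zero>\<^bsub>E\<^esub>" "n \<le> i" "r \<in> carrier R" for e n i r
    using s'[OF that(1-3)] s(1)[of i] that(1,4)
    by (simp add: a_minus_def E.smult_l_distr E.smult_l_minus)
  have "s i \<ominus> s j \<in> ?K n" if ij: "n \<le> i" "n \<le> j" for i j n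
  proof (rule ccontr)
    assume nK: "s i \<ominus> s j \<notin> ?K n"
    have "s i \<ominus> s j \<in> carrier R" using s(1) by simp
    then obtain e where e: "e \<in> carrier E" "\<And>y. y \<in> ?K n \<Longrightarrow> y \<odot>\<^bsub>E\<^esub> e = \<zero>\<^bsub>E\<^esub>"
      "(s i \<ominus> s j) \<odot>\<^bsub>E\<^esub> e \<noteq> \<zero>\<^bsub>E\<^esub>"
      using max_power_faithful[OF _ nK] by metis
    then show False
      using diff[of e n i "s j"] s'[of e n j] ij s(1) by (simp add: a_minus_def E.M.r_neg)
  qed
  then have "\<forall>n. \<exists>k. \<forall>i\<ge>k. \<forall>j\<ge>k. s i \<ominus> s j \<in> ?K n" by blast
  moreover have "adically_complete R \<mm>"
    using complete by (simp add: complete_noetherian_local_ring_def)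
  ultimately obtain r where r: "r \<in> carrier R" "\<And>n. \<exists>k. \<forall>i\<ge>k. s i \<ominus> r \<in> ?K n"
    unfolding adically_complete_def using s(1) by (metis image_subsetI)
  show ?thesis
  proof (rule that[OF r(1)])
    fix e n assume e: "e \<in> carrier E" "\<And>y. y \<in> ?K n \<Longrightarrow> y \<odot>\<^bsub>E\<^esub> e = \<zero>\<^bsub>E\<^esub>"
    obtain k where k: "\<And>i. i \<ge> k \<Longrightarrow> s i \<ominus> r \<in> ?K n" using r(2) by blast
    have "(s (max k n) \<ominus> r) \<odot>\<^bsub>E\<^esub> e = \<zero>\<^bsub>E\<^esub>" using e(2) k by simp
    then have "\<phi> e \<ominus>\<^bsub>E\<^esub> r \<odot>\<^bsub>E\<^esub> e = \<zero>\<^bsub>E\<^esub>" using diff[of e n "max k n" r] e r(1) by simp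
    then show "\<phi> e = r \<odot>\<^bsub>E\<^esub> e"
      using E.M.eq_of_minus_eq_zero mod_homD(1)[OF \<phi> e(1)] e(1) r(1) by simp
  qed
qed

end

section \<open>Duality between Artinian modules and their duals\<close>

context matlis
begin

abbreviation dual :: "('a, 'b) module \<Rightarrow> ('a, 'b \<Rightarrow> 'e) module" where
  "dual B \<equiv> matlis_dual R E B"

abbreviation dual_ann :: "('a, 'b) module \<Rightarrow> 'b set \<Rightarrow> ('b \<Rightarrow> 'e) set" where
  "dual_ann B A \<equiv> dual_of_quotient R E B A"

abbreviation ann :: "('a, 'b) module \<Rightarrow> ('b \<Rightarrow> 'e) set \<Rightarrow> 'b set" where
  "ann B L \<equiv> dual_of_dual_quotient R E B L"

lemma module_dual: "module R B \<Longrightarrow> module R (dual B)"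
  by (rule module_matlis_dual[OF _ E.module_axioms])

lemma mem_ann: "module R B \<Longrightarrow> L \<subseteq> mod_hom R B E \<Longrightarrow>
    b \<in> ann B L \<longleftrightarrow> b \<in> carrier B \<and> (\<forall>f\<in>L. f b = \<zero>\<^bsub>E\<^esub>)"
  by (rule mem_dual_of_dual_quotient[OF _ E.module_axioms])

lemma dual_ann_submodule:
  assumes B: "module R B" and A: "A \<subseteq> carrier B"
  shows "submodule (dual_ann B A) R (dual B)"
proof -
  interpret D: module R "dual B" using module_dual[OF B] .
  have [simp]: "x \<in> carrier B" if "x \<in> A" for x using that A by blast
  show ?thesis
    unfolding D.submodule_iff
    using D.zero_closed D.smult_closed D.a_closed by (auto simp: mem_dual_of_quotient)
qed

lemma ann_submodule:
  assumes B: "module R B" and L: "L \<subseteq> mod_hom R B E"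
  shows "submodule (ann B L) R B"
proof -
  interpret B: module R B by fact
  have Lc: "f \<in> mod_hom R B E" if "f \<in> L" for f using that L by blast
  show ?thesis
    unfolding B.submodule_iff
  proof (intro conjI ballI)
    show "ann B L \<subseteq> carrier B" by (auto simp: mem_ann[OF B L])
    show "\<zero>\<^bsub>B\<^esub> \<in> ann B L"
      using mod_hom_zero[OF B E.module_axioms Lc] by (simp add: mem_ann[OF B L])
  next
    fix x y assume "x \<in> ann B L" "y \<in> ann B L"
    then have c: "x \<in> carrier B" "y \<in> carrier B"
      and z: "\<And>f. f \<in> L \<Longrightarrow> f x = \<zero>\<^bsub>E\<^esub>" "\<And>f. f \<in> L \<Longrightarrow> f y = \<zero>\<^bsub>E\<^esub>"
      unfolding mem_ann[OF B L] by blast+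
    have "f (x \<oplus>\<^bsub>B\<^esub> y) = \<zero>\<^bsub>E\<^esub>" if "f \<in> L" for f
      using mod_homD(2)[OF Lc[OF that] c] z[OF that] by simp
    then show "x \<oplus>\<^bsub>B\<^esub> y \<in> ann B L" using c B.M.a_closed unfolding mem_ann[OF B L] by blast
  next
    fix r x assume r: "r \<in> carrier R" and "x \<in> ann B L"
    then have c: "x \<in> carrier B" and z: "\<And>f. f \<in> L \<Longrightarrow> f x = \<zero>\<^bsub>E\<^esub>"
      unfolding mem_ann[OF B L] by blast+
    have "f (r \<odot>\<^bsub>B\<^esub> x) = \<zero>\<^bsub>E\<^esub>" if "f \<in> L" for f
      using mod_homD(3)[OF Lc[OF that] r c] z[OF that] r by simp
    then show "r \<odot>\<^bsub>B\<^esub> x \<in> ann B L" using c r B.smult_closed unfolding mem_ann[OF B L] by blast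
  qed
qed

lemma ann_dual_ann:
  assumes B: "module R B" and A: "submodule A R B"
  shows "ann B (dual_ann B A) = A"
proof -
  have L: "dual_ann B A \<subseteq> mod_hom R B E" by (auto simp: mem_dual_of_quotient)
  have Ac: "A \<subseteq> carrier B" using module.submoduleE(1)[OF B A] .
  show ?thesis
  proof (intro equalityI subsetI)
    fix b assume b: "b \<in> ann B (dual_ann B A)"
    show "b \<in> A"
    proof (rule ccontr)
      assume "b \<notin> A"
      then obtain f where "f \<in> mod_hom R B E" "\<And>a. a \<in> A \<Longrightarrow> f a = \<zero>\<^bsub>E\<^esub>" "f b \<noteq> \<zero>\<^bsub>E\<^esub>"
        using separating_hom[OF B A, of b] b mem_ann[OF B L, of b] by metis
      then show False using b by (auto simp: mem_ann[OF B L] mem_dual_of_quotient)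
    qed
  next
    fix b assume "b \<in> A"
    then show "b \<in> ann B (dual_ann B A)"
      using Ac by (auto simp: mem_ann[OF B L] mem_dual_of_quotient)
  qed
qed

lemma artinian_torsion:
  assumes B: "B \<in> artinian_modules R" and b: "b \<in> carrier B"
  shows "\<exists>n. \<forall>y\<in>ideal_power R \<mm> n. y \<odot>\<^bsub>B\<^esub> b = \<zero>\<^bsub>B\<^esub>"
proof -
  interpret B: module R B using B by (simp add: artinian_modules_def)
  let ?K = "ideal_power R \<mm>"
  define H where "H n = {y \<odot>\<^bsub>B\<^esub> b | y. y \<in> ?K n}" for n
  have K: "?K n \<subseteq> carrier R" "\<zero> \<in> ?K n" "\<And>x y. x \<in> ?K n \<Longrightarrow> y \<in> ?K n \<Longrightarrow> x \<oplus> y \<in> ?K n"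
    "\<And>r x. r \<in> carrier R \<Longrightarrow> x \<in> ?K n \<Longrightarrow> r \<otimes> x \<in> ?K n" for n
    using ideal_max_power[of n] unfolding ideal_iff by blast+
  have Kc: "x \<in> carrier R" if "x \<in> ?K n" for x n using that K(1) by blast
  have mem: "y \<odot>\<^bsub>B\<^esub> b \<in> H n" if "y \<in> ?K n" for y n using that by (auto simp: H_def)
  have "submodule (H n) R B" for n
    unfolding B.submodule_iff
  proof (intro conjI ballI)
    show "H n \<subseteq> carrier B" using Kc b by (auto simp: H_def)
    show "\<zero>\<^bsub>B\<^esub> \<in> H n" using mem[OF K(2)] b by simp
  next
    fix x y assume "x \<in> H n" "y \<in> H n"
    then obtain r s where rs: "r \<in> ?K n" "s \<in> ?K n" "x = r \<odot>\<^bsub>B\<^esub> b" "y = s \<odot>\<^bsub>B\<^esub> b"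
      unfolding H_def by blast
    then show "x \<oplus>\<^bsub>B\<^esub> y \<in> H n"
      using mem[OF K(3)[OF rs(1,2)]] Kc[OF rs(1)] Kc[OF rs(2)] b by (simp add: B.smult_l_distr)
  next
    fix r x assume r: "r \<in> carrier R" and "x \<in> H n"
    then obtain s where s: "s \<in> ?K n" "x = s \<odot>\<^bsub>B\<^esub> b" unfolding H_def by blast
    then show "r \<odot>\<^bsub>B\<^esub> x \<in> H n"
      using mem[OF K(4)[OF r s(1)]] Kc[OF s(1)] r b by (simp add: B.smult_assoc1)
  qed
  moreover have "H (Suc n) \<subseteq> H n" for n
    unfolding H_def using max_power_antimono[of n "Suc n"] by auto
  ultimately obtain n where n: "\<forall>k\<ge>n. H k = H n"
    using B unfolding artinian_modules_def by blast
  have Hn: "H (Suc n) = H n" by (rule n[rule_format]) simp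
  define I where "I = {r \<in> carrier R. r \<odot>\<^bsub>B\<^esub> b = \<zero>\<^bsub>B\<^esub>}"
  have I: "ideal I R"
    unfolding ideal_iff using b by (auto simp: I_def B.smult_l_distr B.smult_assoc1)
  have "?K n \<subseteq> I"
  proof (rule nakayama_ideal[OF I])
    fix y assume y: "y \<in> ?K n"
    then obtain z where z: "z \<in> ?K (Suc n)" "y \<odot>\<^bsub>B\<^esub> b = z \<odot>\<^bsub>B\<^esub> b"
      using mem[OF y] Hn unfolding H_def by auto
    have "y \<ominus> z \<in> I"
      using z(2) Kc[OF y] Kc[OF z(1)] b
      by (simp add: I_def a_minus_def B.smult_l_distr B.smult_l_minus B.M.r_neg)
    moreover have "y = (y \<ominus> z) \<oplus> z"
      using Kc[OF y] Kc[OF z(1)] by (simp add: a_minus_def a_assoc l_neg)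
    ultimately show "\<exists>a\<in>I. \<exists>y'\<in>?K (Suc n). y = a \<oplus> y'" using z(1) by blast
  qed
  then show ?thesis by (auto simp: I_def)
qed

lemma scalar_multiple_on_submodule:
  assumes B: "B \<in> artinian_modules R" and K: "submodule K R B"
    and f: "f \<in> mod_hom R B E" and g: "g \<in> mod_hom R B E"
    and ker: "\<And>b. b \<in> K \<Longrightarrow> g b = \<zero>\<^bsub>E\<^esub> \<Longrightarrow> f b = \<zero>\<^bsub>E\<^esub>"
  shows "\<exists>r\<in>carrier R. \<forall>b\<in>K. f b = r \<odot>\<^bsub>E\<^esub> g b"
proof -
  interpret B: module R B using B by (simp add: artinian_modules_def)
  note f' = mod_homD[OF f] and g' = mod_homD[OF g]
  have Kc: "b \<in> carrier B" if "b \<in> K" for b using that B.submoduleE(1)[OF K] by blast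
  have K0: "\<zero>\<^bsub>B\<^esub> \<in> K" and Ka: "\<And>a b. a \<in> K \<Longrightarrow> b \<in> K \<Longrightarrow> a \<oplus>\<^bsub>B\<^esub> b \<in> K"
    and Ks: "\<And>r a. r \<in> carrier R \<Longrightarrow> a \<in> K \<Longrightarrow> r \<odot>\<^bsub>B\<^esub> a \<in> K"
    using K unfolding B.submodule_iff by blast+
  define G where "G = {(g b, f b) | b. b \<in> K}"
  have mem: "(g b, f b) \<in> G" if "b \<in> K" for b using that by (auto simp: G_def)
  have "hom_graph R E E G"
    unfolding hom_graph_def
  proof (intro conjI allI impI ballI)
    show "G \<subseteq> carrier E \<times> carrier E" using Kc f' g' by (auto simp: G_def)
  next
    fix x y x' y' assume "(x, y) \<in> G" "(x', y') \<in> G"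
    then obtain b b' where *: "b \<in> K" "b' \<in> K" "x = g b" "y = f b" "x' = g b'" "y' = f b'"
      unfolding G_def by blast
    then show "(x \<oplus>\<^bsub>E\<^esub> x', y \<oplus>\<^bsub>E\<^esub> y') \<in> G"
      using mem[OF Ka[OF *(1,2)]] f' g' Kc by simp
  next
    fix r x y assume r: "r \<in> carrier R" and "(x, y) \<in> G"
    then obtain b where *: "b \<in> K" "x = g b" "y = f b" unfolding G_def by blast
    then show "(r \<odot>\<^bsub>E\<^esub> x, r \<odot>\<^bsub>E\<^esub> y) \<in> G"
      using mem[OF Ks[OF r *(1)]] f' g' Kc r by simp
  next
    fix x y y' assume "(x, y) \<in> G" "(x, y') \<in> G"
    then obtain b b' where *: "b \<in> K" "b' \<in> K" "x = g b" "y = f b" "x = g b'" "y' = f b'"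
      unfolding G_def by blast
    note c = Kc[OF *(1)] Kc[OF *(2)]
    have "b \<ominus>\<^bsub>B\<^esub> b' \<in> K"
      using Ka *(1,2) B.submoduleE(3)[OF K] by (simp add: a_minus_def)
    moreover have "g (b \<ominus>\<^bsub>B\<^esub> b') = \<zero>\<^bsub>E\<^esub>"
      using mod_hom_minus[OF B.module_axioms E.module_axioms g c] *(3,5) g'(1)[OF c(1)]
      by (simp add: a_minus_def E.M.r_neg)
    ultimately have "f b \<ominus>\<^bsub>E\<^esub> f b' = \<zero>\<^bsub>E\<^esub>"
      using ker mod_hom_minus[OF B.module_axioms E.module_axioms f c] by simp
    then show "y = y'" using *(4,6) E.M.eq_of_minus_eq_zero f'(1) c by simp
  qed
  moreover have "(\<zero>\<^bsub>E\<^esub>, \<zero>\<^bsub>E\<^esub>) \<in> G"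
    using mem[OF K0] mod_hom_zero[OF B.module_axioms E.module_axioms f]
      mod_hom_zero[OF B.module_axioms E.module_axioms g] by simp
  ultimately obtain \<phi> where \<phi>: "\<phi> \<in> mod_hom R E E" "\<And>x y. (x, y) \<in> G \<Longrightarrow> \<phi> x = y"
    using hom_graph_extends[OF E.module_axioms] by metis
  obtain r where r: "r \<in> carrier R" "\<And>e n. e \<in> carrier E \<Longrightarrow>
      (\<And>y. y \<in> ideal_power R \<mm> n \<Longrightarrow> y \<odot>\<^bsub>E\<^esub> e = \<zero>\<^bsub>E\<^esub>) \<Longrightarrow> \<phi> e = r \<odot>\<^bsub>E\<^esub> e"
    using endomorphism_scalar[OF \<phi>(1)] by metis
  have "f b = r \<odot>\<^bsub>E\<^esub> g b" if b: "b \<in> K" for b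
  proof -
    obtain n where n: "\<forall>y\<in>ideal_power R \<mm> n. y \<odot>\<^bsub>B\<^esub> b = \<zero>\<^bsub>B\<^esub>"
      using artinian_torsion[OF B Kc[OF b]] ..
    have "y \<odot>\<^bsub>E\<^esub> g b = \<zero>\<^bsub>E\<^esub>" if y: "y \<in> ideal_power R \<mm> n" for y
      using g'(3)[OF ideal.Icarr[OF ideal_max_power y] Kc[OF b]] n[rule_format, OF y]
        mod_hom_zero[OF B.module_axioms E.module_axioms g] by simp
    then have "\<phi> (g b) = r \<odot>\<^bsub>E\<^esub> g b" using r(2) g'(1) Kc[OF b] by blast
    then show ?thesis using \<phi>(2)[OF mem[OF b]] by simp
  qed
  then show ?thesis using r(1) by blast
qed

lemma mem_span_on_submodule:
  assumes B: "B \<in> artinian_modules R" and "finite S" and "S \<subseteq> mod_hom R B E"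
    and "submodule K R B" and f: "f \<in> mod_hom R B E"
    and "\<And>b. b \<in> K \<Longrightarrow> (\<And>g. g \<in> S \<Longrightarrow> g b = \<zero>\<^bsub>E\<^esub>) \<Longrightarrow> f b = \<zero>\<^bsub>E\<^esub>"
  shows "\<exists>h\<in>submodule_span R (dual B) S. \<forall>b\<in>K. f b = h b"
  using assms(2-)
proof (induction S arbitrary: K)
  case empty
  interpret B: module R B using B by (simp add: artinian_modules_def)
  interpret D: module R "dual B" using module_dual[OF B.module_axioms] .
  have "\<zero>\<^bsub>dual B\<^esub> \<in> submodule_span R (dual B) {}"
    using submodule_span_submodule[OF D.module_axioms, of "{}"] D.submodule_iff by blast
  moreover have "f b = \<zero>\<^bsub>dual B\<^esub> b" if "b \<in> K" for b
    using empty(4)[OF that] that empty(2) B.submodule_iff by auto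
  ultimately show ?case by blast
next
  case (insert g S)
  interpret B: module R B using B by (simp add: artinian_modules_def)
  interpret D: module R "dual B" using module_dual[OF B.module_axioms] .
  have g: "g \<in> mod_hom R B E" using insert.prems(1) by blast
  have Kc: "b \<in> carrier B" if "b \<in> K" for b using that B.submoduleE(1)[OF insert.prems(2)] by blast
  let ?K = "K \<inter> {b \<in> carrier B. g b = \<zero>\<^bsub>E\<^esub>}"
  have K: "submodule ?K R B"
    using insert.prems(2) mod_hom_ker_submodule[OF B.module_axioms E.module_axioms g]
    by (rule B.submodule_Int)
  have "\<exists>h\<in>submodule_span R (dual B) S. \<forall>b\<in>?K. f b = h b"
    using insert.prems by (intro insert.IH[OF _ K f]) auto
  then obtain h where h: "h \<in> submodule_span R (dual B) S" "\<And>b. b \<in> ?K \<Longrightarrow> f b = h b" by blast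
  let ?L = "submodule_span R (dual B) (insert g S)"
  have L: "submodule ?L R (dual B)"
    using insert.prems(1) by (intro submodule_span_submodule) (auto simp: D.module_axioms)
  note L' = L[unfolded D.submodule_iff]
  have gL: "g \<in> ?L" using submodule_span_superset[of "insert g S" R "dual B"] by blast
  have hL: "h \<in> ?L"
    using h(1) submodule_span_least[OF L, of S] submodule_span_superset[of "insert g S" R "dual B"]
    by blast
  have hc: "h \<in> mod_hom R B E" using hL L' by auto
  let ?f = "f \<ominus>\<^bsub>dual B\<^esub> h"
  have fc: "?f \<in> mod_hom R B E" using f hc D.M.minus_closed by auto
  have f_eq: "f = h \<oplus>\<^bsub>dual B\<^esub> ?f"
    using f hc D.M.r_neg2[of h f] D.M.a_comm[of "\<ominus>\<^bsub>dual B\<^esub> h" f] D.M.a_inv_closed[of h]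
    by (simp add: a_minus_def del: matlis_dual_simps(2-))
  have fb: "f b = h b \<oplus>\<^bsub>E\<^esub> ?f b" if "b \<in> carrier B" for b
    using arg_cong[OF f_eq, of "\<lambda>u. u b"] that by simp
  have "\<exists>r\<in>carrier R. \<forall>b\<in>K. ?f b = r \<odot>\<^bsub>E\<^esub> g b"
  proof (rule scalar_multiple_on_submodule[OF B insert.prems(2) fc g])
    fix b assume b: "b \<in> K" "g b = \<zero>\<^bsub>E\<^esub>"
    then have "f b = h b" using h(2) Kc by blast
    then show "?f b = \<zero>\<^bsub>E\<^esub>"
      using fb[OF Kc[OF b(1)]] mod_homD(1)[OF hc Kc[OF b(1)]] mod_homD(1)[OF fc Kc[OF b(1)]]
      by (metis E.M.add.l_cancel_one)
  qed
  then obtain r where r: "r \<in> carrier R" "\<And>b. b \<in> K \<Longrightarrow> ?f b = r \<odot>\<^bsub>E\<^esub> g b" by blast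
  have "h \<oplus>\<^bsub>dual B\<^esub> r \<odot>\<^bsub>dual B\<^esub> g \<in> ?L" using L' hL gL r(1) by blast
  moreover have "f b = (h \<oplus>\<^bsub>dual B\<^esub> r \<odot>\<^bsub>dual B\<^esub> g) b" if "b \<in> K" for b
    using fb r(2) Kc that by simp
  ultimately show ?case by blast
qed

lemma ann_finite:
  assumes B: "B \<in> artinian_modules R" and L: "L \<subseteq> mod_hom R B E"
  obtains S where "finite S" "S \<subseteq> L" "ann B S = ann B L"
proof -
  have mB: "module R B" using B by (simp add: artinian_modules_def)
  let ?F = "{ann B S | S. finite S \<and> S \<subseteq> L}"
  have "\<exists>Z\<in>?F. \<forall>Y\<in>?F. Y \<subseteq> Z \<longrightarrow> Y = Z"
  proof (rule artinian_minimal[OF B])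
    show "?F \<noteq> {}" by blast
    fix Z assume "Z \<in> ?F"
    then show "submodule Z R B" using ann_submodule[OF mB] L by blast
  qed
  then obtain Z where "Z \<in> ?F" and Z: "\<forall>Y\<in>?F. Y \<subseteq> Z \<longrightarrow> Y = Z" ..
  then obtain S where S: "finite S" "S \<subseteq> L" and ZS: "Z = ann B S" by blast
  have min: "ann B T = ann B S" if "finite T" "T \<subseteq> L" "ann B T \<subseteq> ann B S" for T
    using Z that unfolding ZS by blast
  have SL: "S \<subseteq> mod_hom R B E" using S(2) L by blast
  have "f b = \<zero>\<^bsub>E\<^esub>" if b: "b \<in> ann B S" and f: "f \<in> L" for b f
  proof -
    have fS: "insert f S \<subseteq> mod_hom R B E" using f SL L by blast
    have "ann B (insert f S) \<subseteq> ann B S"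
      using mem_ann[OF mB fS] mem_ann[OF mB SL] by auto
    then have "ann B (insert f S) = ann B S" using min[of "insert f S"] S f by blast
    then show ?thesis using b mem_ann[OF mB fS] by auto
  qed
  then have "ann B S = ann B L"
    using S(2) mem_ann[OF mB SL] mem_ann[OF mB L] by blast
  with S show ?thesis by (rule that)
qed

lemma dual_submodule_span:
  assumes B: "B \<in> artinian_modules R" and L: "submodule L R (dual B)"
    and S: "finite S" "S \<subseteq> L" and f: "f \<in> mod_hom R B E" "\<And>b. b \<in> ann B S \<Longrightarrow> f b = \<zero>\<^bsub>E\<^esub>"
  shows "f \<in> submodule_span R (dual B) S"
proof -
  interpret B: module R B using B by (simp add: artinian_modules_def)
  interpret D: module R "dual B" using module_dual[OF B.module_axioms] .
  have Sc: "S \<subseteq> mod_hom R B E" using S(2) D.submoduleE(1)[OF L] by auto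
  have "\<exists>h\<in>submodule_span R (dual B) S. \<forall>b\<in>carrier B. f b = h b"
    using f by (intro mem_span_on_submodule[OF B S(1) Sc B.carrier_is_submodule])
      (auto simp: mem_ann[OF B.module_axioms Sc])
  then obtain h where h: "h \<in> submodule_span R (dual B) S" "\<And>b. b \<in> carrier B \<Longrightarrow> f b = h b" by blast
  have "h \<in> mod_hom R B E"
    using h(1) submodule_span_least[OF D.carrier_is_submodule] Sc by auto
  then have "f = h" using f(1) h(2) by (intro mod_hom_eqI) auto
  then show ?thesis using h(1) by simp
qed

lemma dual_ann_ann:
  assumes B: "B \<in> artinian_modules R" and L: "submodule L R (dual B)"
  shows "dual_ann B (ann B L) = L"
proof -
  interpret B: module R B using B by (simp add: artinian_modules_def)
  interpret D: module R "dual B" using module_dual[OF B.module_axioms] .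
  have Lc: "L \<subseteq> mod_hom R B E" using D.submoduleE(1)[OF L] by simp
  obtain S where S: "finite S" "S \<subseteq> L" "ann B S = ann B L" using ann_finite[OF B Lc] .
  show ?thesis
  proof (intro equalityI subsetI)
    fix f assume "f \<in> dual_ann B (ann B L)"
    then have "f \<in> submodule_span R (dual B) S"
      using S(3) by (intro dual_submodule_span[OF B L S(1,2)]) (auto simp: mem_dual_of_quotient)
    then show "f \<in> L" using submodule_span_least[OF L S(2)] by blast
  next
    fix f assume "f \<in> L"
    then show "f \<in> dual_ann B (ann B L)"
      using Lc mem_ann[OF B.module_axioms Lc] by (auto simp: mem_dual_of_quotient)
  qed
qed

lemma dual_submodule_fg:
  assumes B: "B \<in> artinian_modules R" and L: "submodule L R (dual B)"
  shows "(dual B)\<lparr>carrier := L\<rparr> \<in> fg_modules R"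
proof -
  interpret B: module R B using B by (simp add: artinian_modules_def)
  interpret D: module R "dual B" using module_dual[OF B.module_axioms] .
  have Lc: "L \<subseteq> mod_hom R B E" using D.submoduleE(1)[OF L] by simp
  obtain S where S: "finite S" "S \<subseteq> L" "ann B S = ann B L" using ann_finite[OF B Lc] .
  have "submodule_span R (dual B) S = L"
  proof
    show "submodule_span R (dual B) S \<subseteq> L" using submodule_span_least[OF L S(2)] .
    show "L \<subseteq> submodule_span R (dual B) S"
    proof
      fix f assume "f \<in> L"
      then show "f \<in> submodule_span R (dual B) S"
        using S(3) Lc mem_ann[OF B.module_axioms Lc]
        by (intro dual_submodule_span[OF B L S(1,2)]) auto
    qed
  qed
  then show ?thesis
    using S(1,2) submodule.submodule_is_module[OF L D.module_axioms]
      submodule_span_restrict[OF D.module_axioms L S(2)]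
    by (auto simp: fg_modules_def)
qed

lemma dual_fg:
  assumes B: "B \<in> artinian_modules R"
  shows "dual B \<in> fg_modules R"
proof -
  have "module R B" using B by (simp add: artinian_modules_def)
  then have "(dual B)\<lparr>carrier := carrier (dual B)\<rparr> \<in> fg_modules R"
    by (intro dual_submodule_fg[OF B] module.carrier_is_submodule module_dual)
  then show ?thesis by (simp only: module.surjective module.update_convs matlis_dual_def) simp
qed

end

section \<open>The dual interior operation\<close>

context matlis
begin

lemma ann_antimono:
  "module R B \<Longrightarrow> L \<subseteq> L' \<Longrightarrow> L' \<subseteq> mod_hom R B E \<Longrightarrow> ann B L' \<subseteq> ann B L"
  using mem_ann[of B L'] mem_ann[of B L] by blast

lemma dual_ann_antimono: "A \<subseteq> A' \<Longrightarrow> dual_ann B A' \<subseteq> dual_ann B A"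
  unfolding subset_iff mem_dual_of_quotient by blast

lemma dual_ann_subset: "dual_ann B A \<subseteq> mod_hom R B E"
  by (auto simp: mem_dual_of_quotient)

lemma ann_span:
  assumes B: "module R B" and S: "S \<subseteq> mod_hom R B E"
  shows "ann B (submodule_span R (dual B) S) = ann B S"
proof -
  interpret D: module R "dual B" using module_dual[OF B] .
  have span: "submodule (submodule_span R (dual B) S) R (dual B)"
    using submodule_span_submodule[OF D.module_axioms] S by simp
  have spanc: "submodule_span R (dual B) S \<subseteq> mod_hom R B E" using D.submoduleE(1)[OF span] by simp
  have "submodule_span R (dual B) S \<subseteq> dual_ann B (ann B S)"
  proof (rule submodule_span_least)
    show "submodule (dual_ann B (ann B S)) R (dual B)"
      using module.submoduleE(1)[OF B ann_submodule[OF B S]] by (rule dual_ann_submodule[OF B])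
    show "S \<subseteq> dual_ann B (ann B S)"
      using S mem_ann[OF B S] unfolding mem_dual_of_quotient subset_iff by blast
  qed
  then have "ann B S \<subseteq> ann B (submodule_span R (dual B) S)"
    using mem_ann[OF B S] mem_ann[OF B spanc] unfolding mem_dual_of_quotient subset_iff by blast
  then show ?thesis
    using ann_antimono[OF B submodule_span_superset spanc] by blast
qed

lemma dual_ann_span:
  assumes B: "module R B" and S: "S \<subseteq> carrier B"
  shows "dual_ann B (submodule_span R B S) = dual_ann B S"
proof
  show "dual_ann B (submodule_span R B S) \<subseteq> dual_ann B S"
    by (rule dual_ann_antimono) (rule submodule_span_superset)
  show "dual_ann B S \<subseteq> dual_ann B (submodule_span R B S)"
  proof
    fix f assume f: "f \<in> dual_ann B S"
    then have fc: "f \<in> mod_hom R B E" by (simp add: mem_dual_of_quotient)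
    have "submodule_span R B S \<subseteq> {x \<in> carrier B. f x = \<zero>\<^bsub>E\<^esub>}"
      using f S by (intro submodule_span_least mod_hom_ker_submodule[OF B E.module_axioms fc])
        (auto simp: mem_dual_of_quotient)
    then show "f \<in> dual_ann B (submodule_span R B S)"
      using fc by (auto simp: mem_dual_of_quotient)
  qed
qed

lemma submodule_colon_submodule:
  assumes B: "module R B" and A: "submodule A R B"
  shows "submodule (submodule_colon B A \<mm>) R B" "A \<subseteq> submodule_colon B A \<mm>"
proof -
  interpret B: module R B by fact
  note A' = A[unfolded B.submodule_iff]
  have mc: "t \<in> carrier R" if "t \<in> \<mm>" for t using that by (rule \<mm>.Icarr)
  show "A \<subseteq> submodule_colon B A \<mm>" using A' mc unfolding submodule_colon_def by blast
  show "submodule (submodule_colon B A \<mm>) R B"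
    unfolding B.submodule_iff
  proof (intro conjI ballI)
    show "submodule_colon B A \<mm> \<subseteq> carrier B" by (auto simp: submodule_colon_def)
    show "\<zero>\<^bsub>B\<^esub> \<in> submodule_colon B A \<mm>" using A' mc by (simp add: submodule_colon_def)
  next
    fix a b assume "a \<in> submodule_colon B A \<mm>" "b \<in> submodule_colon B A \<mm>"
    then show "a \<oplus>\<^bsub>B\<^esub> b \<in> submodule_colon B A \<mm>"
      using A' mc by (simp add: submodule_colon_def B.smult_r_distr)
  next
    fix r a assume "r \<in> carrier R" "a \<in> submodule_colon B A \<mm>"
    then show "r \<odot>\<^bsub>B\<^esub> a \<in> submodule_colon B A \<mm>"
      using A' mc by (auto simp: submodule_colon_def B.smult_left_commute[of _ r])
  qed
qed

lemma ann_ideal_smult: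
  assumes B: "module R B" and A: "submodule A R B"
  shows "ann B (ideal_smult R (dual B) \<mm> (dual_ann B A)) = submodule_colon B A \<mm>"
proof -
  interpret B: module R B by fact
  interpret D: module R "dual B" using module_dual[OF B] .
  let ?N = "dual_ann B A"
  let ?S = "{r \<odot>\<^bsub>dual B\<^esub> x | r x. r \<in> \<mm> \<and> x \<in> ?N}"
  have N: "f \<in> mod_hom R B E" if "f \<in> ?N" for f using that dual_ann_subset by blast
  have S: "?S \<subseteq> mod_hom R B E"
    using D.smult_closed \<mm>.Icarr N by (auto simp del: matlis_dual_simps(4))
  have "b \<in> ann B ?S \<longleftrightarrow> b \<in> submodule_colon B A \<mm>" if b: "b \<in> carrier B" for b
  proof -
    have "b \<in> ann B ?S \<longleftrightarrow> (\<forall>r\<in>\<mm>. \<forall>f\<in>?N. (r \<odot>\<^bsub>dual B\<^esub> f) b = \<zero>\<^bsub>E\<^esub>)"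
      using b unfolding mem_ann[OF B S] by blast
    also have "\<dots> \<longleftrightarrow> (\<forall>r\<in>\<mm>. \<forall>f\<in>?N. f (r \<odot>\<^bsub>B\<^esub> b) = \<zero>\<^bsub>E\<^esub>)"
      using mod_homD(3)[OF N \<mm>.Icarr b] b by (intro ball_cong refl) simp
    also have "\<dots> \<longleftrightarrow> (\<forall>r\<in>\<mm>. r \<odot>\<^bsub>B\<^esub> b \<in> ann B ?N)"
      using mem_ann[OF B dual_ann_subset] B.smult_closed[OF \<mm>.Icarr b] by blast
    also have "\<dots> \<longleftrightarrow> b \<in> submodule_colon B A \<mm>"
      using b unfolding ann_dual_ann[OF B A] by (simp add: submodule_colon_def)
    finally show ?thesis .
  qed
  moreover have "ann B ?S \<subseteq> carrier B" "submodule_colon B A \<mm> \<subseteq> carrier B"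
    using mem_ann[OF B S] by (auto simp: submodule_colon_def)
  ultimately have "ann B ?S = submodule_colon B A \<mm>" by blast
  then show ?thesis unfolding ideal_smult_def ann_span[OF B S] .
qed

text \<open>
  The values \<open>(g x)\<^bsub>g \<in> S\<^esub>\<close> lie in a power of the one-dimensional socle of \<open>E\<close>, so their span
  cannot grow infinitely often.
\<close>

lemma chain_socle_values:
  assumes B: "module R B" and "finite S" and "S \<subseteq> mod_hom R B E"
    and "C \<noteq> {}" and "\<And>D. D \<in> C \<Longrightarrow> submodule D R B"
    and "\<And>D D'. D \<in> C \<Longrightarrow> D' \<in> C \<Longrightarrow> D \<subseteq> D' \<or> D' \<subseteq> D"
    and "\<And>D x g t. D \<in> C \<Longrightarrow> x \<in> D \<Longrightarrow> g \<in> S \<Longrightarrow> t \<in> \<mm> \<Longrightarrow> t \<odot>\<^bsub>E\<^esub> g x = \<zero>\<^bsub>E\<^esub>"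
  shows "\<exists>D\<in>C. \<forall>x\<in>\<Union>C. \<exists>y\<in>D. \<forall>g\<in>S. g x = g y"
  using assms(2-)
proof (induction S arbitrary: C)
  case empty
  then obtain D where D: "D \<in> C" by blast
  then have "D \<noteq> {}" using module.submoduleE(2)[OF B] empty(3) by blast
  then show ?case using D by blast
next
  case (insert g S)
  interpret B: module R B by fact
  note sub = insert.prems(3) and chain = insert.prems(4) and soc = insert.prems(5)
  have S: "S \<subseteq> mod_hom R B E" and g: "g \<in> mod_hom R B E" using insert.prems(1) by auto
  let ?ker = "{x \<in> carrier B. g x = \<zero>\<^bsub>E\<^esub>}"
  have Dc: "x \<in> carrier B" if "D \<in> C" "x \<in> D" for x D
    using B.submoduleE(1)[OF sub[OF that(1)]] that(2) by blast
  have "\<exists>D'\<in>(\<lambda>D. D \<inter> ?ker) ` C. \<forall>x\<in>\<Union>((\<lambda>D. D \<inter> ?ker) ` C). \<exists>y\<in>D'. \<forall>g\<in>S. g x = g y"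
  proof (rule insert.IH[OF S])
    show "(\<lambda>D. D \<inter> ?ker) ` C \<noteq> {}" using insert.prems(2) by blast
    show "submodule D R B" if "D \<in> (\<lambda>D. D \<inter> ?ker) ` C" for D
      using that sub B.submodule_Int[OF _ mod_hom_ker_submodule[OF B E.module_axioms g]] by blast
    show "D \<subseteq> D' \<or> D' \<subseteq> D" if "D \<in> (\<lambda>D. D \<inter> ?ker) ` C" "D' \<in> (\<lambda>D. D \<inter> ?ker) ` C" for D D'
    proof -
      from that obtain F F' where "F \<in> C" "F' \<in> C" "D = F \<inter> ?ker" "D' = F' \<inter> ?ker" by blast
      then show ?thesis using chain[of F F'] by blast
    qed
    show "t \<odot>\<^bsub>E\<^esub> h x = \<zero>\<^bsub>E\<^esub>" if "D \<in> (\<lambda>D. D \<inter> ?ker) ` C" "x \<in> D" "h \<in> S" "t \<in> \<mm>" for D x h t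
      using that soc by blast
  qed
  then obtain D1 where D1: "D1 \<in> C" and
    D1': "\<And>x. x \<in> \<Union>C \<Longrightarrow> x \<in> carrier B \<Longrightarrow> g x = \<zero>\<^bsub>E\<^esub> \<Longrightarrow> \<exists>y\<in>D1 \<inter> ?ker. \<forall>h\<in>S. h x = h y" by blast
  show ?case
  proof (cases "\<forall>x\<in>\<Union>C. g x = \<zero>\<^bsub>E\<^esub>")
    case True
    have "\<exists>y\<in>D1. \<forall>h\<in>insert g S. h x = h y" if x: "x \<in> \<Union>C" for x
    proof -
      have gx: "g x = \<zero>\<^bsub>E\<^esub>" using True x by blast
      obtain y where "y \<in> D1" "g y = \<zero>\<^bsub>E\<^esub>" "\<forall>h\<in>S. h x = h y"
        using D1'[OF x _ gx] Dc x by blast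
      then show ?thesis using gx by (intro bexI[of _ y]) auto
    qed
    then show ?thesis using D1 by blast
  next
    case False
    then obtain D2 u where u: "D2 \<in> C" "u \<in> D2" "g u \<noteq> \<zero>\<^bsub>E\<^esub>" by blast
    obtain D where D: "D \<in> C" "D1 \<subseteq> D" "u \<in> D" using chain[OF D1 u(1)] D1 u by blast
    obtain e where e: "e \<in> carrier E" "\<And>t. t \<in> \<mm> \<Longrightarrow> t \<odot>\<^bsub>E\<^esub> e = \<zero>\<^bsub>E\<^esub>"
      and gen: "\<And>x. x \<in> carrier E \<Longrightarrow> (\<And>t. t \<in> \<mm> \<Longrightarrow> t \<odot>\<^bsub>E\<^esub> x = \<zero>\<^bsub>E\<^esub>) \<Longrightarrow> \<exists>r\<in>carrier R. x = r \<odot>\<^bsub>E\<^esub> e"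
      using socle_generator by metis
    have gval: "\<exists>r\<in>carrier R. g x = r \<odot>\<^bsub>E\<^esub> e" if "F \<in> C" "x \<in> F" for x F
      using gen[OF mod_homD(1)[OF g Dc[OF that]]] soc[OF that insertI1] by blast
    have uc: "u \<in> carrier B" using Dc u by blast
    obtain r where r: "r \<in> carrier R" "g u = r \<odot>\<^bsub>E\<^esub> e" using gval u by blast
    have "r \<notin> \<mm>" using r(2) e(2) u(3) by auto
    then obtain v where v: "v \<in> carrier R" "v \<otimes> r = \<one>" using inverse_of_non_max[OF r(1)] by blast
    have ev: "e = v \<odot>\<^bsub>E\<^esub> g u" using E.smult_assoc1[OF v(1) r(1) e(1)] v(2) r(2) e(1) by simp
    have "\<exists>y\<in>D. \<forall>h\<in>insert g S. h x = h y" if x: "x \<in> \<Union>C" for x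
    proof -
      obtain F where F: "F \<in> C" "x \<in> F" using x by blast
      have xc: "x \<in> carrier B" using Dc F by blast
      obtain p where p: "p \<in> carrier R" "g x = p \<odot>\<^bsub>E\<^esub> e" using gval[OF F] by blast
      let ?w = "(p \<otimes> v) \<odot>\<^bsub>B\<^esub> u"
      have pv: "p \<otimes> v \<in> carrier R" using p(1) v(1) by simp
      have wc: "?w \<in> carrier B" using pv uc by simp
      have wD: "?w \<in> D" using B.submoduleE(4)[OF sub[OF D(1)] pv D(3)] .
      have gw: "g x = g ?w"
        using mod_homD(3)[OF g pv uc] E.smult_assoc1[OF p(1) v(1) mod_homD(1)[OF g uc]] ev p(2) by simp
      let ?z = "x \<ominus>\<^bsub>B\<^esub> ?w"
      have zc: "?z \<in> carrier B" using xc wc by simp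
      have gz: "g ?z = \<zero>\<^bsub>E\<^esub>"
        using mod_hom_minus[OF B E.module_axioms g xc wc] gw mod_homD(1)[OF g wc]
        by (simp add: a_minus_def E.M.r_neg)
      obtain F' where F': "F' \<in> C" "x \<in> F'" "?w \<in> F'" using chain[OF F(1) D(1)] F D(1) wD by blast
      have "?z \<in> F'"
        using B.submoduleE(3,5)[OF sub[OF F'(1)]] F'(2,3) by (simp add: a_minus_def)
      then have "?z \<in> \<Union>C" using F'(1) by blast
      then obtain y where y: "y \<in> D1" "y \<in> carrier B" "g y = \<zero>\<^bsub>E\<^esub>" "\<And>h. h \<in> S \<Longrightarrow> h ?z = h y"
        using D1'[OF _ zc gz] by blast
      have x_eq: "x = ?z \<oplus>\<^bsub>B\<^esub> ?w" using xc wc by (simp add: a_minus_def B.M.a_assoc B.M.l_neg)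
      have "h x = h (y \<oplus>\<^bsub>B\<^esub> ?w)" if "h \<in> insert g S" for h
      proof -
        have h: "h \<in> mod_hom R B E" using that insert.prems(1) by blast
        have "h ?z = h y" using that y(3,4) gz by auto
        then show ?thesis
          using mod_homD(2)[OF h zc wc] mod_homD(2)[OF h y(2) wc] x_eq by simp
      qed
      moreover have "y \<oplus>\<^bsub>B\<^esub> ?w \<in> D"
        using B.submoduleE(5)[OF sub[OF D(1)]] y(1) D(2) wD by blast
      ultimately show ?thesis by blast
    qed
    then show ?thesis using D(1) by blast
  qed
qed

text \<open>\<open>(A : \<mm>)/A\<close> embeds into a power of the socle of \<open>E\<close>, hence is Noetherian.\<close>

lemma chain_colon_stationary:
  assumes B: "B \<in> artinian_modules R" and A: "submodule A R B" and "C \<noteq> {}"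
    and sub: "\<And>D. D \<in> C \<Longrightarrow> submodule D R B \<and> A \<subseteq> D"
    and chain: "\<And>D D'. D \<in> C \<Longrightarrow> D' \<in> C \<Longrightarrow> D \<subseteq> D' \<or> D' \<subseteq> D"
  shows "\<exists>D\<in>C. \<Union>C \<inter> submodule_colon B A \<mm> \<subseteq> D"
proof -
  have mB: "module R B" using B by (simp add: artinian_modules_def)
  interpret B: module R B by fact
  let ?W = "submodule_colon B A \<mm>"
  obtain S where S: "finite S" "S \<subseteq> dual_ann B A" "ann B S = ann B (dual_ann B A)"
    using ann_finite[OF B dual_ann_subset] .
  have SA: "ann B S = A" using S(3) ann_dual_ann[OF mB A] by simp
  have Sc: "S \<subseteq> mod_hom R B E" using S(2) dual_ann_subset by blast
  have W: "submodule ?W R B" using submodule_colon_submodule[OF mB A] by blast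
  have "\<exists>D'\<in>(\<lambda>D. D \<inter> ?W) ` C. \<forall>x\<in>\<Union>((\<lambda>D. D \<inter> ?W) ` C). \<exists>y\<in>D'. \<forall>g\<in>S. g x = g y"
  proof (rule chain_socle_values[OF mB S(1) Sc])
    show "(\<lambda>D. D \<inter> ?W) ` C \<noteq> {}" using \<open>C \<noteq> {}\<close> by blast
    show "submodule D R B" if "D \<in> (\<lambda>D. D \<inter> ?W) ` C" for D
      using that sub B.submodule_Int[OF _ W] by blast
    show "D \<subseteq> D' \<or> D' \<subseteq> D" if "D \<in> (\<lambda>D. D \<inter> ?W) ` C" "D' \<in> (\<lambda>D. D \<inter> ?W) ` C" for D D'
    proof -
      from that obtain F F' where "F \<in> C" "F' \<in> C" "D = F \<inter> ?W" "D' = F' \<inter> ?W" by blast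
      then show ?thesis using chain[of F F'] by blast
    qed
    show "t \<odot>\<^bsub>E\<^esub> g x = \<zero>\<^bsub>E\<^esub>" if "D \<in> (\<lambda>D. D \<inter> ?W) ` C" "x \<in> D" "g \<in> S" "t \<in> \<mm>" for D x g t
    proof -
      have "x \<in> carrier B" "t \<odot>\<^bsub>B\<^esub> x \<in> A" using that by (auto simp: submodule_colon_def)
      moreover have "g \<in> dual_ann B A" using that(3) S(2) by blast
      ultimately show ?thesis
        using mod_homD(3)[of g R B E t x] \<mm>.Icarr[OF that(4)] by (auto simp: mem_dual_of_quotient)
    qed
  qed
  then obtain D where D: "D \<in> C"
    and D': "\<And>x. x \<in> \<Union>C \<Longrightarrow> x \<in> ?W \<Longrightarrow> \<exists>y\<in>D \<inter> ?W. \<forall>g\<in>S. g x = g y" by blast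
  have "x \<in> D" if x: "x \<in> \<Union>C" "x \<in> ?W" for x
  proof -
    obtain y where y: "y \<in> D" "y \<in> ?W" "\<And>g. g \<in> S \<Longrightarrow> g x = g y" using D'[OF x] by blast
    have c: "x \<in> carrier B" "y \<in> carrier B" using x(2) y(2) by (auto simp: submodule_colon_def)
    have "g (x \<ominus>\<^bsub>B\<^esub> y) = \<zero>\<^bsub>E\<^esub>" if "g \<in> S" for g
    proof -
      have g: "g \<in> mod_hom R B E" using that Sc by blast
      show ?thesis
        using mod_hom_minus[OF mB E.module_axioms g c] y(3)[OF that] mod_homD(1)[OF g c(2)]
        by (simp add: a_minus_def E.M.r_neg)
    qed
    then have "x \<ominus>\<^bsub>B\<^esub> y \<in> ann B S" using c B.M.minus_closed unfolding mem_ann[OF mB Sc] by blast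
    then have "x \<ominus>\<^bsub>B\<^esub> y \<in> D" using sub[OF D] unfolding SA by blast
    then have "(x \<ominus>\<^bsub>B\<^esub> y) \<oplus>\<^bsub>B\<^esub> y \<in> D" using B.submoduleE(5) sub[OF D] y(1) by blast
    then show ?thesis using c by (simp add: a_minus_def B.M.a_assoc B.M.l_neg)
  qed
  then show ?thesis using D by blast
qed

end

locale matlis_closure = matlis R \<mm> E
  for R :: "('a, 'r) ring_scheme" (structure) and \<mm> :: "'a set" and E :: "('a, 'e) module" +
  fixes cl :: "('a, 'b \<Rightarrow> 'e) module \<Rightarrow> ('b \<Rightarrow> 'e) set \<Rightarrow> ('b \<Rightarrow> 'e) set"
  assumes closure: "closure_operation R (fg_modules R) cl"
    and residual: "residual R (fg_modules R) cl"
    and nakayama: "nakayama_closure R \<mm> cl"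
begin

abbreviation interior :: "('a, 'b) module \<Rightarrow> 'b set" where
  "interior \<equiv> dual_interior R E cl"

lemma closure_dual:
  assumes B: "B \<in> artinian_modules R" and L: "submodule L R (dual B)"
  shows "submodule (cl (dual B) L) R (dual B)" "L \<subseteq> cl (dual B) L"
    "cl (dual B) (cl (dual B) L) = cl (dual B) L"
  using closure[unfolded closure_operation_def, THEN conjunct1, rule_format, OF dual_fg[OF B] L]
  by simp_all

lemma closure_dual_mono:
  assumes B: "B \<in> artinian_modules R" and "submodule L R (dual B)" "submodule N R (dual B)" "L \<subseteq> N"
  shows "cl (dual B) L \<subseteq> cl (dual B) N"
  using closure[unfolded closure_operation_def, THEN conjunct2, rule_format, OF dual_fg[OF B]] assms(2-)
  by simp

text \<open>
  By residuality applied to the restriction map \<open>B\<^sup>\<or> \<rightarrow> A\<^sup>\<or>\<close>, whose kernel is \<open>(B/A)\<^sup>\<or>\<close>, interiors of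
  all submodules of \<open>B\<close> are read off from the closure in the single module \<open>B\<^sup>\<or>\<close>.
\<close>

lemma interior_submodule_eq:
  assumes B: "B \<in> artinian_modules R" and A: "submodule A R B"
  shows "interior (B\<lparr>carrier := A\<rparr>) = ann B (cl (dual B) (dual_ann B A))"
proof -
  have mB: "module R B" using B by (simp add: artinian_modules_def)
  let ?A = "B\<lparr>carrier := A\<rparr>"
  have aA: "?A \<in> artinian_modules R" using artinian_restrict[OF B A] .
  then have mA: "module R ?A" by (simp add: artinian_modules_def)
  interpret B: module R B by fact
  have Ac: "x \<in> carrier B" if "x \<in> A" for x using B.submoduleE(1)[OF A] that by blast
  define \<rho> where "\<rho> = (\<lambda>f\<in>mod_hom R B E. restrict f A)"
  have \<rho>: "\<rho> f \<in> mod_hom R ?A E" if "f \<in> mod_hom R B E" for f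
    using mod_hom_restrict[OF that mB A] that by (simp add: \<rho>_def)
  have \<rho>_eq: "\<rho> f x = f x" if "f \<in> mod_hom R B E" "x \<in> A" for f x
    using that by (simp add: \<rho>_def)
  interpret D: module R "dual B" using module_dual[OF mB] .
  interpret DA: module R "dual ?A" using module_dual[OF mA] .
  have \<rho>_hom: "\<rho> \<in> mod_hom R (dual B) (dual ?A)"
  proof (rule mod_homI)
    fix f assume "f \<in> carrier (dual B)"
    then show "\<rho> f \<in> carrier (dual ?A)" using \<rho> by simp
  next
    fix f g assume "f \<in> carrier (dual B)" "g \<in> carrier (dual B)"
    then show "\<rho> (f \<oplus>\<^bsub>dual B\<^esub> g) = \<rho> f \<oplus>\<^bsub>dual ?A\<^esub> \<rho> g"
      using D.M.a_closed[of f g] Ac by (auto simp: \<rho>_def fun_eq_iff)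
  next
    fix r f assume "r \<in> carrier R" "f \<in> carrier (dual B)"
    then show "\<rho> (r \<odot>\<^bsub>dual B\<^esub> f) = r \<odot>\<^bsub>dual ?A\<^esub> \<rho> f"
      using D.smult_closed[of r f] Ac by (auto simp: \<rho>_def fun_eq_iff)
  qed (simp add: \<rho>_def)
  have surj: "\<exists>f\<in>mod_hom R B E. \<rho> f = g" if g: "g \<in> mod_hom R ?A E" for g
  proof -
    have "\<forall>g\<in>mod_hom R ?A E. \<exists>f\<in>mod_hom R B E. \<forall>x\<in>A. f x = g x"
      using injective[where 'n = 'b] mB A unfolding injective_module_def by (elim conjE allE impE) auto
    then obtain f where f: "f \<in> mod_hom R B E" "\<forall>x\<in>A. f x = g x" using g by blast
    have "\<rho> f = g"
    proof (rule mod_hom_eqI[OF \<rho>[OF f(1)] g])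
      fix x assume "x \<in> carrier ?A"
      then show "\<rho> f x = g x" using f \<rho>_eq by simp
    qed
    then show ?thesis using f(1) by blast
  qed
  have img: "\<rho> ` carrier (dual B) = carrier (dual ?A)" using \<rho> surj by auto
  have ker: "{f \<in> carrier (dual B). \<rho> f = \<zero>\<^bsub>dual ?A\<^esub>} = dual_ann B A"
    by (auto simp: \<rho>_def fun_eq_iff mem_dual_of_quotient restrict_def)
  have cl_eq: "cl (dual B) (dual_ann B A) =
      {f \<in> carrier (dual B). \<rho> f \<in> cl (dual ?A) {\<zero>\<^bsub>dual ?A\<^esub>}}"
    using residual[unfolded residual_def, rule_format, OF dual_fg[OF B] dual_fg[OF aA] \<rho>_hom img]
    unfolding ker .
  note Asub = B.submoduleE(1)[OF A]
  have N: "submodule (dual_ann B A) R (dual B)" using dual_ann_submodule[OF mB Asub] .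
  have clc: "cl (dual B) (dual_ann B A) \<subseteq> mod_hom R B E"
    using D.submoduleE(1)[OF closure_dual(1)[OF B N]] by simp
  have clAc: "cl (dual ?A) {\<zero>\<^bsub>dual ?A\<^esub>} \<subseteq> mod_hom R ?A E"
    using DA.submoduleE(1)[OF closure_dual(1)[OF aA DA.submodule_zero]] by simp
  have cA: "carrier ?A = A" by simp
  note mem_A = mem_ann[OF mA clAc, unfolded cA] and mem_B = mem_ann[OF mB clc]
  show ?thesis
    unfolding dual_interior_def
  proof (intro equalityI subsetI)
    fix b assume "b \<in> ann ?A (cl (dual ?A) {\<zero>\<^bsub>dual ?A\<^esub>})"
    then have b: "b \<in> A" "\<And>g. g \<in> cl (dual ?A) {\<zero>\<^bsub>dual ?A\<^esub>} \<Longrightarrow> g b = \<zero>\<^bsub>E\<^esub>"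
      unfolding mem_A by blast+
    have "f b = \<zero>\<^bsub>E\<^esub>" if f: "f \<in> cl (dual B) (dual_ann B A)" for f
    proof -
      have "f \<in> mod_hom R B E" using f clc by blast
      moreover have "\<rho> f \<in> cl (dual ?A) {\<zero>\<^bsub>dual ?A\<^esub>}" using f unfolding cl_eq by blast
      ultimately show ?thesis using b(2) \<rho>_eq[OF _ b(1)] by metis
    qed
    then show "b \<in> ann B (cl (dual B) (dual_ann B A))"
      using Ac[OF b(1)] unfolding mem_B by blast
  next
    fix b assume b: "b \<in> ann B (cl (dual B) (dual_ann B A))"
    then have bA: "b \<in> A"
      using ann_antimono[OF mB closure_dual(2)[OF B N] clc] ann_dual_ann[OF mB A] by blast
    have "g b = \<zero>\<^bsub>E\<^esub>" if g: "g \<in> cl (dual ?A) {\<zero>\<^bsub>dual ?A\<^esub>}" for g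
    proof -
      obtain f where f: "f \<in> mod_hom R B E" "\<rho> f = g" using surj g clAc by blast
      then have "f \<in> cl (dual B) (dual_ann B A)" using g unfolding cl_eq by simp
      then have "f b = \<zero>\<^bsub>E\<^esub>" using b unfolding mem_B by blast
      then show ?thesis using f(2) \<rho>_eq[OF f(1) bA] by simp
    qed
    then show "b \<in> ann ?A (cl (dual ?A) {\<zero>\<^bsub>dual ?A\<^esub>})"
      using bA unfolding mem_A by blast
  qed
qed

lemma interior_eq: "interior B = ann B (cl (dual B) {\<zero>\<^bsub>dual B\<^esub>})"
  by (simp only: dual_interior_def)

context
  fixes B :: "('a, 'b) module"
  assumes B: "B \<in> artinian_modules R"
begin

lemma module_B: "module R B"
  using B by (simp add: artinian_modules_def)

interpretation B: module R B by (rule module_B)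
interpretation D: module R "dual B" by (rule module_dual[OF module_B])

lemma dual_ann_sub: "submodule A R B \<Longrightarrow> submodule (dual_ann B A) R (dual B)"
  by (rule dual_ann_submodule[OF module_B B.submoduleE(1)])

lemma closure_subset: "submodule L R (dual B) \<Longrightarrow> cl (dual B) L \<subseteq> mod_hom R B E"
  using D.submoduleE(1)[OF closure_dual(1)[OF B]] by simp

lemma interior_subset:
  assumes A: "submodule A R B"
  shows "interior (B\<lparr>carrier := A\<rparr>) \<subseteq> A"
  unfolding interior_submodule_eq[OF B A]
  using ann_antimono[OF module_B closure_dual(2)[OF B dual_ann_sub[OF A]]
      closure_subset[OF dual_ann_sub[OF A]]]
    ann_dual_ann[OF module_B A] by simp

lemma interior_mono:
  assumes "submodule A R B" "submodule A' R B" "A \<subseteq> A'"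
  shows "interior (B\<lparr>carrier := A\<rparr>) \<subseteq> interior (B\<lparr>carrier := A'\<rparr>)"
  unfolding interior_submodule_eq[OF B assms(1)] interior_submodule_eq[OF B assms(2)]
  by (rule ann_antimono[OF module_B closure_dual_mono[OF B dual_ann_sub[OF assms(2)]
      dual_ann_sub[OF assms(1)] dual_ann_antimono[OF assms(3)]] closure_subset[OF dual_ann_sub[OF assms(1)]]])

lemma dual_ann_interior:
  assumes A: "submodule A R B"
  shows "dual_ann B (interior (B\<lparr>carrier := A\<rparr>)) = cl (dual B) (dual_ann B A)"
  unfolding interior_submodule_eq[OF B A]
  by (rule dual_ann_ann[OF B closure_dual(1)[OF B dual_ann_sub[OF A]]])

lemma interior_eq_iff:
  assumes "submodule A R B" "submodule A' R B"
  shows "interior (B\<lparr>carrier := A\<rparr>) = interior (B\<lparr>carrier := A'\<rparr>) \<longleftrightarrow>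
    cl (dual B) (dual_ann B A) = cl (dual B) (dual_ann B A')"
  using dual_ann_interior[OF assms(1)] dual_ann_interior[OF assms(2)]
    interior_submodule_eq[OF B assms(1)] interior_submodule_eq[OF B assms(2)] by metis

lemma interior_submodule: "submodule (interior B) R B"
  unfolding interior_eq
  by (rule ann_submodule[OF module_B closure_subset[OF D.submodule_zero]])

lemma interior_idem: "interior (B\<lparr>carrier := interior B\<rparr>) = interior B"
proof -
  have "dual_ann B (interior B) = cl (dual B) {\<zero>\<^bsub>dual B\<^esub>}"
    unfolding interior_eq by (rule dual_ann_ann[OF B closure_dual(1)[OF B D.submodule_zero]])
  then show ?thesis
    using interior_submodule_eq[OF B interior_submodule] closure_dual(3)[OF B D.submodule_zero]
      interior_eq[of B] by simp
qed

lemma interior_nakayama: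
  assumes A: "submodule A R B" and sub: "interior (B\<lparr>carrier := submodule_colon B A \<mm>\<rparr>) \<subseteq> A"
  shows "interior (B\<lparr>carrier := A\<rparr>) = interior B"
proof -
  let ?N = "dual_ann B A" and ?mN = "ideal_smult R (dual B) \<mm> (dual_ann B A)"
  note N = dual_ann_sub[OF A]
  note W = submodule_colon_submodule(1)[OF module_B A]
  have "{r \<odot>\<^bsub>dual B\<^esub> x | r x. r \<in> \<mm> \<and> x \<in> ?N} \<subseteq> carrier (dual B)"
    using D.smult_closed[OF \<mm>.Icarr] D.submoduleE(1)[OF N] by blast
  then have mN: "submodule ?mN R (dual B)"
    unfolding ideal_smult_def by (rule submodule_span_submodule[OF D.module_axioms])
  have "dual_ann B (submodule_colon B A \<mm>) = ?mN"
    using ann_ideal_smult[OF module_B A] dual_ann_ann[OF B mN] by simp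
  then have "?N \<subseteq> cl (dual B) ?mN"
    using dual_ann_antimono[OF sub, of B] dual_ann_interior[OF W] by simp
  moreover have "{\<zero>\<^bsub>dual B\<^esub>} <+>\<^bsub>dual B\<^esub> ?mN = ?mN"
    using D.submoduleE(1)[OF mN] unfolding set_add_def' by (force simp del: matlis_dual_simps)
  moreover have "\<zero>\<^bsub>dual B\<^esub> \<in> ?N" using N D.submodule_iff by blast
  ultimately have "cl (dual B) {\<zero>\<^bsub>dual B\<^esub>} = cl (dual B) ?N"
    using nakayama dual_fg[OF B] D.submodule_zero N dual_submodule_fg[OF B D.submodule_zero]
      dual_submodule_fg[OF B N]
    unfolding nakayama_closure_def by (metis empty_subsetI insert_subset)
  then show ?thesis
    unfolding interior_submodule_eq[OF B A] interior_eq[of B] by simp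
qed

lemma expansionD:
  assumes "C \<in> i_expansions R interior B A"
  shows "submodule C R B" "A \<subseteq> C" "interior (B\<lparr>carrier := A\<rparr>) = interior (B\<lparr>carrier := C\<rparr>)"
  using assms by (simp_all add: i_expansions_def)

lemma expansions_reductions:
  assumes A: "submodule A R B"
  shows "bij_betw (dual_ann B) (i_expansions R interior B A)
    (cl_reductions R cl (dual B) (dual_ann B A))"
proof (rule bij_betw_byWitness[where f' = "ann B"])
  show "\<forall>C\<in>i_expansions R interior B A. ann B (dual_ann B C) = C"
    using ann_dual_ann[OF module_B] expansionD(1) by blast
  show "\<forall>L\<in>cl_reductions R cl (dual B) (dual_ann B A). dual_ann B (ann B L) = L"
    using dual_ann_ann[OF B] by (simp add: cl_reductions_def)
  show "dual_ann B ` i_expansions R interior B A \<subseteq> cl_reductions R cl (dual B) (dual_ann B A)"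
  proof (intro image_subsetI)
    fix C assume C: "C \<in> i_expansions R interior B A"
    note C' = expansionD[OF C]
    show "dual_ann B C \<in> cl_reductions R cl (dual B) (dual_ann B A)"
      using dual_ann_sub[OF C'(1)] dual_ann_antimono[OF C'(2)] interior_eq_iff[OF A C'(1)] C'(3)
      by (simp add: cl_reductions_def)
  qed
  show "ann B ` cl_reductions R cl (dual B) (dual_ann B A) \<subseteq> i_expansions R interior B A"
  proof (intro image_subsetI)
    fix L assume "L \<in> cl_reductions R cl (dual B) (dual_ann B A)"
    then have L: "submodule L R (dual B)" "L \<subseteq> dual_ann B A"
      "cl (dual B) L = cl (dual B) (dual_ann B A)"
      by (auto simp: cl_reductions_def)
    have Lc: "L \<subseteq> mod_hom R B E" using L(2) dual_ann_subset by blast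
    note C = ann_submodule[OF module_B Lc]
    have "A \<subseteq> ann B L"
      using ann_antimono[OF module_B L(2) dual_ann_subset] ann_dual_ann[OF module_B A] by simp
    then show "ann B L \<in> i_expansions R interior B A"
      using C L(3) interior_eq_iff[OF A C] dual_ann_ann[OF B L(1)] by (simp add: i_expansions_def)
  qed
qed

lemma self_expansion: "submodule A R B \<Longrightarrow> A \<in> i_expansions R interior B A"
  by (simp add: i_expansions_def)

lemma expansions_chain_Union:
  assumes A: "submodule A R B" and "C \<noteq> {}" and C: "C \<subseteq> i_expansions R interior B A"
    and chain: "\<And>D D'. D \<in> C \<Longrightarrow> D' \<in> C \<Longrightarrow> D \<subseteq> D' \<or> D' \<subseteq> D"
  shows "\<Union>C \<in> i_expansions R interior B A"
proof -
  let ?U = "\<Union>C" and ?W = "submodule_colon B A \<mm>"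
  have sub: "submodule D R B \<and> A \<subseteq> D" if "D \<in> C" for D
    using expansionD(1,2)[OF subsetD[OF C that]] by blast
  have U: "submodule ?U R B"
    by (rule B.submodule_Union_chain[OF \<open>C \<noteq> {}\<close> conjunct1[OF sub] chain])
  have AU: "A \<subseteq> ?U" using sub \<open>C \<noteq> {}\<close> by blast
  have "\<exists>D\<in>C. ?U \<inter> ?W \<subseteq> D"
    by (rule chain_colon_stationary[OF B A \<open>C \<noteq> {}\<close> sub chain])
  then obtain D where D: "D \<in> C" "?U \<inter> ?W \<subseteq> D" ..
  note D' = expansionD[OF subsetD[OF C D(1)]]
  have UW: "submodule (?U \<inter> ?W) R B"
    using B.submodule_Int[OF U submodule_colon_submodule(1)[OF module_B A]] .
  have "interior (B\<lparr>carrier := ?U \<inter> ?W\<rparr>) \<subseteq> interior (B\<lparr>carrier := A\<rparr>)"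
    using interior_mono[OF UW D'(1) D(2)] D'(3) by simp
  then have int_sub: "interior (B\<lparr>carrier := ?U \<inter> ?W\<rparr>) \<subseteq> A" using interior_subset[OF A] by blast
  have colon: "submodule_colon (B\<lparr>carrier := ?U\<rparr>) A \<mm> = ?U \<inter> ?W"
    using B.submoduleE(1)[OF U] by (auto simp: submodule_colon_def)
  have "interior (B\<lparr>carrier := ?U\<rparr>\<lparr>carrier := A\<rparr>) = interior (B\<lparr>carrier := ?U\<rparr>)"
  proof (rule matlis_closure.interior_nakayama[OF matlis_closure_axioms artinian_restrict[OF B U]])
    show "submodule A R (B\<lparr>carrier := ?U\<rparr>)"
      using A AU submodule_restrict_iff[OF module_B U] by blast
    show "interior (B\<lparr>carrier := ?U\<rparr>\<lparr>carrier := submodule_colon (B\<lparr>carrier := ?U\<rparr>) A \<mm>\<rparr>) \<subseteq> A"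
      using int_sub by (simp add: colon)
  qed
  then show ?thesis using U AU by (simp add: i_expansions_def)
qed

lemma maximal_expansion:
  assumes A: "submodule A R B" and C: "C \<in> i_expansions R interior B A"
  shows "\<exists>D\<in>i_expansions R interior B A. C \<subseteq> D \<and>
    (\<forall>D'\<in>i_expansions R interior B A. D \<subseteq> D' \<longrightarrow> D' = D)"
proof -
  let ?F = "{D \<in> i_expansions R interior B A. C \<subseteq> D}"
  have "\<exists>D\<in>?F. \<forall>D'\<in>?F. D \<subseteq> D' \<longrightarrow> D' = D"
  proof (rule subset_Zorn_nonempty)
    show "?F \<noteq> {}" using C by blast
    fix K assume K: "K \<noteq> {}" "subset.chain ?F K"
    have "\<Union>K \<in> i_expansions R interior B A"
    proof (rule expansions_chain_Union[OF A K(1)])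
      show "K \<subseteq> i_expansions R interior B A" using K(2) unfolding subset.chain_def by blast
      show "D \<subseteq> D' \<or> D' \<subseteq> D" if "D \<in> K" "D' \<in> K" for D D'
        using K(2) that unfolding subset_chain_def by blast
    qed
    moreover have "C \<subseteq> \<Union>K" using K unfolding subset.chain_def by blast
    ultimately show "\<Union>K \<in> ?F" by blast
  qed
  then obtain D where DF: "D \<in> ?F" and max: "\<forall>D'\<in>?F. D \<subseteq> D' \<longrightarrow> D' = D" ..
  then have D: "D \<in> i_expansions R interior B A" "C \<subseteq> D" by simp_all
  have "D' = D" if "D' \<in> i_expansions R interior B A" "D \<subseteq> D'" for D'
    by (rule max[rule_format]) (use D(2) that in auto)
  then show ?thesis by (intro bexI[OF _ D(1)] conjI D(2) ballI impI)
qed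

lemma hull_eq:
  assumes A: "submodule A R B"
  shows "submodule (i_hull R interior B A) R B"
    "i_hull R interior B A = ann B (cl_core R cl (dual B) (dual_ann B A))"
proof -
  let ?X = "i_expansions R interior B A"
  have Xc: "\<Union>?X \<subseteq> carrier B" by (rule Union_least) (rule B.submoduleE(1)[OF expansionD(1)])
  show hull: "submodule (i_hull R interior B A) R B"
    unfolding i_hull_def submodule_sum_def by (rule submodule_span_submodule[OF module_B Xc])
  have "cl_core R cl (dual B) (dual_ann B A) = \<Inter>(dual_ann B ` ?X)"
    using bij_betw_imp_surj_on[OF expansions_reductions[OF A]] by (simp add: cl_core_def)
  also have "\<dots> = dual_ann B (\<Union>?X)"
    using self_expansion[OF A] unfolding dual_of_quotient_def by blast
  also have "\<dots> = dual_ann B (i_hull R interior B A)"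
    unfolding i_hull_def submodule_sum_def dual_ann_span[OF module_B Xc] ..
  finally show "i_hull R interior B A = ann B (cl_core R cl (dual B) (dual_ann B A))"
    using ann_dual_ann[OF module_B hull] by simp
qed

end

end

context matlis_closure
begin

lemma interior_iso:
  assumes M: "M \<in> artinian_modules R" and N: "N \<in> artinian_modules R"
    and \<phi>: "\<phi> \<in> mod_hom R M N" and bij: "bij_betw \<phi> (carrier M) (carrier N)"
  shows "\<phi> ` interior M = interior N"
proof -
  have mM: "module R M" and mN: "module R N" using M N by (simp_all add: artinian_modules_def)
  interpret M: module R M by fact
  interpret N: module R N by fact
  interpret DM: module R "dual M" using module_dual[OF mM] .
  interpret DN: module R "dual N" using module_dual[OF mN] .
  note \<phi>' = mod_homD[OF \<phi>]
  have inj: "inj_on \<phi> (carrier M)" and img: "\<phi> ` carrier M = carrier N"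
    using bij by (simp_all add: bij_betw_def)
  define \<rho> where "\<rho> = (\<lambda>g\<in>mod_hom R N E. \<lambda>x\<in>carrier M. g (\<phi> x))"
  have \<rho>: "\<rho> g \<in> mod_hom R M E" if "g \<in> mod_hom R N E" for g
    using that \<phi>' mod_homD(1-3)[OF that] by (intro mod_homI) (simp_all add: \<rho>_def)
  have \<rho>_eq: "\<rho> g x = g (\<phi> x)" if "g \<in> mod_hom R N E" "x \<in> carrier M" for g x
    using that by (simp add: \<rho>_def)
  have \<rho>_hom: "\<rho> \<in> mod_hom R (dual N) (dual M)"
  proof (rule mod_homI)
    fix f assume "f \<in> carrier (dual N)"
    then show "\<rho> f \<in> carrier (dual M)" using \<rho> by simp
  next
    fix f g assume "f \<in> carrier (dual N)" "g \<in> carrier (dual N)"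
    then show "\<rho> (f \<oplus>\<^bsub>dual N\<^esub> g) = \<rho> f \<oplus>\<^bsub>dual M\<^esub> \<rho> g"
      using DN.M.a_closed[of f g] \<phi>'(1) by (auto simp: \<rho>_def fun_eq_iff)
  next
    fix r f assume "r \<in> carrier R" "f \<in> carrier (dual N)"
    then show "\<rho> (r \<odot>\<^bsub>dual N\<^esub> f) = r \<odot>\<^bsub>dual M\<^esub> \<rho> f"
      using DN.smult_closed[of r f] \<phi>'(1) by (auto simp: \<rho>_def fun_eq_iff)
  qed (simp add: \<rho>_def)
  have surj: "\<exists>g\<in>mod_hom R N E. \<rho> g = h" if h: "h \<in> mod_hom R M E" for h
  proof -
    note h' = mod_homD[OF h]
    let ?\<psi> = "inv_into (carrier M) \<phi>"
    have \<psi>: "?\<psi> y \<in> carrier M" "\<phi> (?\<psi> y) = y" if "y \<in> carrier N" for y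
      using that img inv_into_into f_inv_into_f by metis+
    have \<psi>\<phi>: "?\<psi> (\<phi> x) = x" if "x \<in> carrier M" for x using inv_into_f_f[OF inj that] .
    have \<psi>a: "?\<psi> (y \<oplus>\<^bsub>N\<^esub> z) = ?\<psi> y \<oplus>\<^bsub>M\<^esub> ?\<psi> z" if "y \<in> carrier N" "z \<in> carrier N" for y z
      using \<psi>\<phi>[of "?\<psi> y \<oplus>\<^bsub>M\<^esub> ?\<psi> z"] \<phi>'(2) \<psi> that by simp
    have \<psi>s: "?\<psi> (r \<odot>\<^bsub>N\<^esub> y) = r \<odot>\<^bsub>M\<^esub> ?\<psi> y" if "r \<in> carrier R" "y \<in> carrier N" for r y
      using \<psi>\<phi>[of "r \<odot>\<^bsub>M\<^esub> ?\<psi> y"] \<phi>'(3) \<psi> that by simp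
    let ?g = "\<lambda>y\<in>carrier N. h (?\<psi> y)"
    have g: "?g \<in> mod_hom R N E"
      using h'(1-3) \<psi>(1) \<psi>a \<psi>s by (intro mod_homI) simp_all
    have "\<rho> ?g = h"
      using \<rho>_eq[OF g] \<phi>'(1) \<psi>\<phi> by (intro mod_hom_eqI[OF \<rho>[OF g] h]) simp
    then show ?thesis using g by blast
  qed
  have \<rho>img: "\<rho> ` carrier (dual N) = carrier (dual M)" using \<rho> surj by auto
  have ker: "{g \<in> carrier (dual N). \<rho> g = \<zero>\<^bsub>dual M\<^esub>} = {\<zero>\<^bsub>dual N\<^esub>}"
  proof (intro equalityI subsetI)
    fix g assume "g \<in> {g \<in> carrier (dual N). \<rho> g = \<zero>\<^bsub>dual M\<^esub>}"
    then have g: "g \<in> mod_hom R N E" "\<rho> g = \<zero>\<^bsub>dual M\<^esub>" by simp_all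
    have "g = \<zero>\<^bsub>dual N\<^esub>"
    proof (rule mod_hom_eqI[OF g(1)])
      show "\<zero>\<^bsub>dual N\<^esub> \<in> mod_hom R N E" using DN.zero_closed by simp
      fix y assume "y \<in> carrier N"
      then obtain x where "x \<in> carrier M" "y = \<phi> x" using img by blast
      then show "g y = \<zero>\<^bsub>dual N\<^esub> y" using \<rho>_eq[OF g(1)] g(2) \<phi>'(1) by simp
    qed
    then show "g \<in> {\<zero>\<^bsub>dual N\<^esub>}" by blast
  next
    fix g assume "g \<in> {\<zero>\<^bsub>dual N\<^esub>}"
    then have g: "g = \<zero>\<^bsub>dual N\<^esub>" by blast
    have "\<rho> \<zero>\<^bsub>dual N\<^esub> = \<zero>\<^bsub>dual M\<^esub>"
      by (rule mod_hom_zero[OF DN.module_axioms DM.module_axioms \<rho>_hom])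
    then show "g \<in> {g \<in> carrier (dual N). \<rho> g = \<zero>\<^bsub>dual M\<^esub>}" using DN.zero_closed unfolding g by blast
  qed
  let ?CM = "cl (dual M) {\<zero>\<^bsub>dual M\<^esub>}" and ?CN = "cl (dual N) {\<zero>\<^bsub>dual N\<^esub>}"
  have cl_eq: "?CN = {g \<in> carrier (dual N). \<rho> g \<in> ?CM}"
    using residual[unfolded residual_def, rule_format, OF dual_fg[OF N] dual_fg[OF M] \<rho>_hom \<rho>img]
    unfolding ker .
  note mem_M = mem_ann[OF mM closure_subset[OF M DM.submodule_zero]]
    and mem_N = mem_ann[OF mN closure_subset[OF N DN.submodule_zero]]
  have iff: "\<phi> x \<in> interior N \<longleftrightarrow> x \<in> interior M" if x: "x \<in> carrier M" for x
  proof -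
    have "(\<forall>g\<in>?CN. g (\<phi> x) = \<zero>\<^bsub>E\<^esub>) \<longleftrightarrow> (\<forall>h\<in>?CM. h x = \<zero>\<^bsub>E\<^esub>)"
    proof (intro iffI ballI)
      fix h assume *: "\<forall>g\<in>?CN. g (\<phi> x) = \<zero>\<^bsub>E\<^esub>" and h: "h \<in> ?CM"
      obtain g where g: "g \<in> mod_hom R N E" "\<rho> g = h"
        using surj h closure_subset[OF M DM.submodule_zero] by blast
      then have "g \<in> ?CN" using h unfolding cl_eq by simp
      then have "g (\<phi> x) = \<zero>\<^bsub>E\<^esub>" using * by blast
      then show "h x = \<zero>\<^bsub>E\<^esub>" using \<rho>_eq[OF g(1) x] g(2) by simp
    next
      fix g assume *: "\<forall>h\<in>?CM. h x = \<zero>\<^bsub>E\<^esub>" and "g \<in> ?CN"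
      then have g: "g \<in> mod_hom R N E" "\<rho> g \<in> ?CM" unfolding cl_eq by simp_all
      have "\<rho> g x = \<zero>\<^bsub>E\<^esub>" using * g(2) by blast
      then show "g (\<phi> x) = \<zero>\<^bsub>E\<^esub>" using \<rho>_eq[OF g(1) x] by simp
    qed
    then show ?thesis unfolding interior_eq mem_M mem_N using x \<phi>'(1) by blast
  qed
  have sub: "interior M \<subseteq> carrier M" "interior N \<subseteq> carrier N"
    using M.submoduleE(1)[OF interior_submodule[OF M]] N.submoduleE(1)[OF interior_submodule[OF N]] .
  show ?thesis
  proof (intro equalityI subsetI)
    fix y assume "y \<in> \<phi> ` interior M"
    then obtain x where "x \<in> interior M" "y = \<phi> x" ..
    then show "y \<in> interior N" using iff[OF subsetD[OF sub(1)]] by simp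
  next
    fix y assume y: "y \<in> interior N"
    then obtain x where x: "y = \<phi> x" "x \<in> carrier M" using subsetD[OF sub(2) y] img by (auto simp: image_iff)
    then have "x \<in> interior M" using y iff by simp
    then show "y \<in> \<phi> ` interior M" using x(1) by simp
  qed
qed

lemma interior_operation: "interior_operation R (artinian_modules R) interior"
  unfolding interior_operation_def
proof (intro conjI ballI allI impI)
  fix M :: "('a, 'b) module" and L
  assume M: "M \<in> artinian_modules R" and L: "submodule L R M"
  have mM: "module R M" using M by (simp add: artinian_modules_def)
  have "interior (M\<lparr>carrier := L\<rparr>) \<subseteq> interior (M\<lparr>carrier := carrier M\<rparr>)"
    by (rule interior_mono[OF M L module.carrier_is_submodule[OF mM] module.submoduleE(1)[OF mM L]])
  then show "interior (M\<lparr>carrier := L\<rparr>) \<subseteq> interior M" by simp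
qed (simp_all add: interior_submodule interior_iso interior_idem)

lemma nakayama_interior: "nakayama_interior R \<mm> interior"
  unfolding nakayama_interior_def using interior_nakayama by blast

end

theorem theoremA:
  fixes R :: "('a, 'r) ring_scheme" and \<mm> :: "'a set"
    and E :: "('a, 'e) module"
    and cl :: "('a, 'b \<Rightarrow> 'e) module \<Rightarrow> ('b \<Rightarrow> 'e) set \<Rightarrow> ('b \<Rightarrow> 'e) set"
    and i :: "('a, 'b) module \<Rightarrow> 'b set"
  assumes "complete_noetherian_local_ring R \<mm>"
    and "injective_hull R (residue_module R \<mm>) E"
    and "closure_operation R (fg_modules R) cl"
    and "residual R (fg_modules R) cl"
    and "nakayama_closure R \<mm> cl"
  defines "i \<equiv> dual_interior R E cl"
  shows "interior_operation R (artinian_modules R) i \<and> nakayama_interior R \<mm> i \<and>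
    (\<forall>B\<in>artinian_modules R. \<forall>A. submodule A R B \<longrightarrow>
      (let M = matlis_dual R E B; N = dual_of_quotient R E B A in
        (\<exists>f. bij_betw f (i_expansions R i B A) (cl_reductions R cl M N) \<and>
             (\<forall>C\<in>i_expansions R i B A. \<forall>D\<in>i_expansions R i B A. C \<subseteq> D \<longleftrightarrow> f D \<subseteq> f C)) \<and>
        (\<forall>C\<in>i_expansions R i B A. \<exists>D\<in>i_expansions R i B A. C \<subseteq> D \<and>
             (\<forall>D'\<in>i_expansions R i B A. D \<subseteq> D' \<longrightarrow> D' = D)) \<and>
        submodule (i_hull R i B A) R B \<and>
        i_hull R i B A = dual_of_dual_quotient R E B (cl_core R cl M N)))"
proof -
  interpret matlis_closure R \<mm> E cl
    using assms(1-5) by unfold_locales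
  have "let M = matlis_dual R E B; N = dual_of_quotient R E B A in
        (\<exists>f. bij_betw f (i_expansions R i B A) (cl_reductions R cl M N) \<and>
             (\<forall>C\<in>i_expansions R i B A. \<forall>D\<in>i_expansions R i B A. C \<subseteq> D \<longleftrightarrow> f D \<subseteq> f C)) \<and>
        (\<forall>C\<in>i_expansions R i B A. \<exists>D\<in>i_expansions R i B A. C \<subseteq> D \<and>
             (\<forall>D'\<in>i_expansions R i B A. D \<subseteq> D' \<longrightarrow> D' = D)) \<and>
        submodule (i_hull R i B A) R B \<and>
        i_hull R i B A = dual_of_dual_quotient R E B (cl_core R cl M N)"
    if B: "B \<in> artinian_modules R" and A: "submodule A R B" for B :: "('a, 'b) module" and A
    unfolding Let_def i_def
  proof (intro conjI exI[of _ "dual_ann B"] ballI)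
    have mB: "module R B" using B by (simp add: artinian_modules_def)
    fix C D assume "C \<in> i_expansions R interior B A" "D \<in> i_expansions R interior B A"
    note C = expansionD(1)[OF B this(1)] and D = expansionD(1)[OF B this(2)]
    show "C \<subseteq> D \<longleftrightarrow> dual_ann B D \<subseteq> dual_ann B C"
      using dual_ann_antimono[of C D B] ann_antimono[OF mB _ dual_ann_subset, of "dual_ann B D" C]
        ann_dual_ann[OF mB C] ann_dual_ann[OF mB D] by auto
  qed (rule expansions_reductions[OF B A] maximal_expansion[OF B A] hull_eq[OF B A] | assumption)+
  then show ?thesis
    using interior_operation nakayama_interior unfolding i_def by blast
qed

end
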